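(* If $\pi$ is a virtually polycyclic group, then the characteristic variety $\mathcal{V}^i_1(\pi)$ is finite, for all $i$.
   Context: For a finitely generated group $\pi$, $\mathbb{T}(\pi)=\mathrm{Hom}(\pi,\mathbb{C}^\times)$ is the character torus. For $\rho\in\mathbb{T}(\pi)$, $\mathbb{C}_\rho$ is the right $\pi$-module $\mathbb{C}$ with $z\cdot g=z\rho(g)$. The characteristic varieties are $\mathcal{V}^i_r(\pi)=\{\rho\in\mathbb{T}(\pi):\dim H_i(\pi,\mathbb{C}_\rho)\ge r\}$ (group homology with twisted coefficients). *)

theory Defs
  imports Complex_Main "HOL-Algebra.Elementary_Groups"
begin

definition finitely_generated_group :: "('a, 'b) monoid_scheme \<Rightarrow> bool" where
  "finitely_generated_group G \<longleftrightarrow>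
     (\<exists>S. finite S \<and> S \<subseteq> carrier G \<and> generate G S = carrier G)"

definition polycyclic :: "('a, 'b) monoid_scheme \<Rightarrow> bool" where
  "polycyclic G \<longleftrightarrow>
     (\<exists>Hs. Hs \<noteq> [] \<and> hd Hs = carrier G \<and> last Hs = {\<one>\<^bsub>G\<^esub>} \<and>
        (\<forall>j. Suc j < length Hs \<longrightarrow>
           subgroup (Hs ! Suc j) G \<and>
           normal (Hs ! Suc j) (G\<lparr>carrier := Hs ! j\<rparr>) \<and>
           cyclic_group ((G\<lparr>carrier := Hs ! j\<rparr>) Mod (Hs ! Suc j))))"

definition virtually_polycyclic :: "('a, 'b) monoid_scheme \<Rightarrow> bool" where
  "virtually_polycyclic G \<longleftrightarrow>
     (\<exists>H. subgroup H G \<and> finite (rcosets\<^bsub>G\<^esub> H) \<and> polycyclic (G\<lparr>carrier := H\<rparr>))"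

definition char_torus :: "('a, 'b) monoid_scheme \<Rightarrow> ('a \<Rightarrow> complex) set" where
  "char_torus G = {\<rho> \<in> extensional (carrier G).
      (\<forall>x\<in>carrier G. \<rho> x \<noteq> 0) \<and>
      (\<forall>x\<in>carrier G. \<forall>y\<in>carrier G. \<rho> (x \<otimes>\<^bsub>G\<^esub> y) = \<rho> x * \<rho> y)}"

text \<open>C_n(G; C_rho) = C_rho \<otimes> Z[G^n]: finitely supported complex functions on
  words [g_1,...,g_n] of length n in the carrier.\<close>
definition bar_chains :: "('a, 'b) monoid_scheme \<Rightarrow> nat \<Rightarrow> ('a list \<Rightarrow> complex) set" where
  "bar_chains G n = {c. finite {w. c w \<noteq> 0} \<and>
      (\<forall>w. c w \<noteq> 0 \<longrightarrow> length w = n \<and> set w \<subseteq> carrier G)}"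

text \<open>[g_1|...|g_j g_(j+1)|...|g_n] for 1 \<le> j < n.\<close>
definition bar_merge :: "('a, 'b) monoid_scheme \<Rightarrow> nat \<Rightarrow> 'a list \<Rightarrow> 'a list" where
  "bar_merge G j w = take (j - 1) w @ [w ! (j - 1) \<otimes>\<^bsub>G\<^esub> w ! j] @ drop (j + 1) w"

text \<open>Coefficient of the basis word v in the boundary of basis word w (length n):
  d(z[g_1|...|g_n]) = z rho(g_1)[g_2|...|g_n]
     + sum_(j=1)^(n-1) (-1)^j z[...|g_j g_(j+1)|...] + (-1)^n z[g_1|...|g_(n-1)],
  and d = 0 on C_0.\<close>
definition bar_bd_coeff ::
  "('a, 'b) monoid_scheme \<Rightarrow> ('a \<Rightarrow> complex) \<Rightarrow> nat \<Rightarrow> 'a list \<Rightarrow> 'a list \<Rightarrow> complex" where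
  "bar_bd_coeff G \<rho> n w v =
     (if n = 0 then 0 else
       (if tl w = v then \<rho> (hd w) else 0)
       + (\<Sum>j\<in>{1..<n}. (-1) ^ j * (if bar_merge G j w = v then 1 else 0))
       + (-1) ^ n * (if butlast w = v then 1 else 0))"

definition bar_bd ::
  "('a, 'b) monoid_scheme \<Rightarrow> ('a \<Rightarrow> complex) \<Rightarrow> nat \<Rightarrow> ('a list \<Rightarrow> complex) \<Rightarrow> ('a list \<Rightarrow> complex)" where
  "bar_bd G \<rho> n c = (\<lambda>v. \<Sum>w\<in>{w. c w \<noteq> 0}. c w * bar_bd_coeff G \<rho> n w v)"

definition bar_cycles where
  "bar_cycles G \<rho> n = {c \<in> bar_chains G n. bar_bd G \<rho> n c = (\<lambda>_. 0)}"

definition bar_boundaries where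
  "bar_boundaries G \<rho> n = bar_bd G \<rho> (Suc n) ` bar_chains G (Suc n)"

definition homology_dim_ge ::
  "('a, 'b) monoid_scheme \<Rightarrow> ('a \<Rightarrow> complex) \<Rightarrow> nat \<Rightarrow> nat \<Rightarrow> bool" where
  "homology_dim_ge G \<rho> n r \<longleftrightarrow>
     (\<exists>zs :: ('a list \<Rightarrow> complex) list. length zs = r \<and> set zs \<subseteq> bar_cycles G \<rho> n \<and>
        (\<forall>a :: nat \<Rightarrow> complex.
           (\<lambda>v. \<Sum>k<r. a k * (zs ! k) v) \<in> bar_boundaries G \<rho> n \<longrightarrow> (\<forall>k<r. a k = 0)))"

definition char_variety :: "('a, 'b) monoid_scheme \<Rightarrow> nat \<Rightarrow> nat \<Rightarrow> ('a \<Rightarrow> complex) set" where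
  "char_variety G i r = {\<rho> \<in> char_torus G. homology_dim_ge G \<rho> i r}"

end

theory Submission
  imports Defs "HOL-Library.Function_Algebras" "HOL-Computational_Algebra.Polynomial"
begin

text \<open>
  Over a field, nonvanishing of twisted homology is equivalent to nonvanishing of the dual
  cohomology, which is computed by the homogeneous cochains on the whole group \<open>G\<close> that are
  equivariant under a subgroup \<open>N\<close> with respect to a character. The ambient \<open>G\<close> stays fixed while
  \<open>N\<close> runs through a polycyclic series, so no comparison of resolutions is needed, and the degrees
  can be lumped together. The property propagated along the series is: the total cohomology of \<open>N\<close> is
  finite dimensional for every character and vanishes for all but finitely many characters.
  It passes from \<open>M\<close> to \<open>N\<close> if \<open>M\<close> has finite index (averaging over cosets; restriction of
  characters has finite fibres), and if \<open>N / M\<close> is infinite cyclic, generated by \<open>t\<close>: then the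
  \<open>N\<close>-cochains are the kernel of the surjective operator \<open>T - \<chi> t\<close> on the \<open>M\<close>-cochains, where \<open>T\<close> is
  translation by \<open>t\<close>, and vanishing can only fail if \<open>\<chi>\<close> restricts to one of the finitely many
  exceptional characters of \<open>M\<close> and \<open>\<chi> t\<close> is a root of a polynomial that annihilates the action of \<open>T\<close>
  on the finite-dimensional cohomology of \<open>M\<close>.
\<close>

section \<open>Operators that are algebraic modulo a subspace\<close>

text \<open>Dropping one generator \<open>s\<close> from \<open>S\<close> shrinks \<open>V\<close>
  to the subspace \<open>U\<close>, and a single vector outside \<open>U\<close> makes up for the
  loss. With \<open>f\<close> the identity, generators of \<open>V\<close> modulo \<open>B\<close>
  that need not lie in \<open>V\<close> are replaced by generators that do.\<close>

lemma (in Vector_Spaces.linear) finite_span_vimage: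
  assumes "finite S" "vs1.subspace V" "f ` V \<subseteq> vs2.span (S \<union> B)"
  shows "\<exists>S'. finite S' \<and> S' \<subseteq> V \<and> V \<subseteq> vs1.span (S' \<union> {v \<in> V. f v \<in> vs2.span B})"
  using assms
proof (induction S arbitrary: V rule: finite_induct)
  case empty
  have "V \<subseteq> vs1.span ({} \<union> {v \<in> V. f v \<in> vs2.span B})"
    using empty by (auto intro: vs1.span_base)
  then show ?case by blast
next
  case (insert s S)
  define U where "U = {v \<in> V. f v \<in> vs2.span (S \<union> B)}"
  have U: "vs1.subspace U"
    unfolding U_def using insert.prems(1)
    by (auto simp: vs1.subspace_def add scale zero vs2.span_zero vs2.span_add vs2.span_scale)
  obtain S' where S': "finite S'" "S' \<subseteq> U" "U \<subseteq> vs1.span (S' \<union> {v \<in> U. f v \<in> vs2.span B})"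
    using insert.IH[OF U] by (auto simp: U_def)
  have mono: "vs1.span (S' \<union> {v \<in> U. f v \<in> vs2.span B}) \<subseteq> vs1.span (S' \<union> {v \<in> V. f v \<in> vs2.span B})"
    by (rule vs1.span_mono) (auto simp: U_def)
  show ?case
  proof (cases "V = U")
    case True
    with S' show ?thesis by blast
  next
    case False
    then obtain v0 where v0: "v0 \<in> V" "f v0 \<notin> vs2.span (S \<union> B)"
      unfolding U_def by blast
    have mem: "\<exists>k. f v - s2 k s \<in> vs2.span (S \<union> B)" if "v \<in> V" for v
    proof -
      have "f v \<in> vs2.span (insert s (S \<union> B))" using insert.prems(2) that by auto
      then show ?thesis by (simp add: vs2.span_insert)
    qed
    obtain k where k: "f v0 - s2 k s \<in> vs2.span (S \<union> B)" using mem v0 by blast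
    have k0: "k \<noteq> 0" using k v0 by auto
    have "V \<subseteq> vs1.span (insert v0 S' \<union> {v \<in> V. f v \<in> vs2.span B})"
    proof
      fix v assume v: "v \<in> V"
      obtain l where l: "f v - s2 l s \<in> vs2.span (S \<union> B)" using mem v by blast
      \<comment> \<open>The factor \<open>l / k\<close> cancels the coefficient of
        \<open>s\<close>.\<close>
      have "f (v - s1 (l / k) v0) = (f v - s2 l s) - s2 (l / k) (f v0 - s2 k s)"
        using k0 by (simp add: diff scale vs2.scale_right_diff_distrib)
      also have "\<dots> \<in> vs2.span (S \<union> B)"
        by (rule vs2.span_diff[OF l vs2.span_scale[OF k]])
      finally have "v - s1 (l / k) v0 \<in> U"
        unfolding U_def using v v0 insert.prems(1)
        by (auto intro: vs1.subspace_diff vs1.subspace_scale)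
      then have "v - s1 (l / k) v0 \<in> vs1.span (S' \<union> {v \<in> V. f v \<in> vs2.span B})"
        using S' mono by blast
      then show "v \<in> vs1.span (insert v0 S' \<union> {v \<in> V. f v \<in> vs2.span B})"
        unfolding Un_insert_left vs1.span_insert by blast
    qed
    then show ?thesis
      using S' v0 by (intro exI[of _ "insert v0 S'"]) (auto simp: U_def)
  qed
qed

section \<open>Polynomials in a linear operator\<close>

lemma vector_space_smult: "vector_space (smult :: 'a::field \<Rightarrow> 'a poly \<Rightarrow> 'a poly)"
  by unfold_locales (simp_all add: smult_add_right smult_add_left)

text \<open>Degrees are bounded on the span of a finite set. This is what forces annihilating
  polynomials to exist.\<close>

lemma UNIV_poly_not_finite_span:
  fixes S :: "'a::field poly set"
  assumes "finite S"
  shows "module.span smult S \<noteq> UNIV"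
proof
  interpret P: vector_space "smult :: 'a \<Rightarrow> 'a poly \<Rightarrow> 'a poly" by (rule vector_space_smult)
  assume UNIV: "P.span S = UNIV"
  define n where "n = Suc (Max (insert 0 (degree ` S)))"
  have "P.subspace {p. degree p < n}"
    by (auto simp: P.subspace_def n_def intro: degree_add_less le_less_trans[OF degree_smult_le])
  moreover have "S \<subseteq> {p. degree p < n}"
    using assms by (auto simp: n_def less_Suc_eq_le intro!: Max_ge)
  ultimately have "P.span S \<subseteq> {p. degree p < n}" by (rule P.span_minimal[rotated])
  moreover have "monom (1::'a) n \<notin> {p. degree p < n}" by (simp add: degree_monom_eq)
  ultimately show False using UNIV by blast
qed

locale vector_space_operator = vector_space scale + T: Vector_Spaces.linear scale scale T
  for scale :: "'a::field \<Rightarrow> 'b::ab_group_add \<Rightarrow> 'b" (infixr \<open>*s\<close> 75) and T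
begin

text \<open>The vector \<open>p(T) v\<close> in Horner form, so that the algebraic laws follow by
  induction over \<open>pCons\<close>.\<close>

definition poly_op :: "'a poly \<Rightarrow> 'b \<Rightarrow> 'b" where
  "poly_op p = fold_coeffs (\<lambda>a g v. a *s v + T (g v)) p (\<lambda>_. 0)"

lemma poly_op_0 [simp]: "poly_op 0 v = 0"
  by (simp add: poly_op_def)

lemma poly_op_pCons [simp]: "poly_op (pCons a p) v = a *s v + T (poly_op p v)"
  by (cases "p = 0 \<and> a = 0") (auto simp: poly_op_def T.zero)

lemma poly_op_add: "poly_op (p + q) v = poly_op p v + poly_op q v"
  by (induction p q rule: poly_induct2) (simp_all add: scale_left_distrib T.add)

lemma poly_op_smult: "poly_op (smult c p) v = c *s poly_op p v"
  by (induction p) (simp_all add: scale_right_distrib T.scale)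

lemma poly_op_diff: "poly_op (p - q) v = poly_op p v - poly_op q v"
  using poly_op_add[of "p - q" q v] by (simp add: algebra_simps)

lemma poly_op_mult: "poly_op (p * q) v = poly_op p (poly_op q v)"
  by (induction p) (simp_all add: poly_op_add poly_op_smult)

lemma poly_op_linear: "Vector_Spaces.linear scale scale (poly_op p)"
proof -
  have "poly_op p (v + w) = poly_op p v + poly_op p w" for v w
    by (induction p) (simp_all add: scale_right_distrib T.add)
  moreover have "poly_op p (c *s v) = c *s poly_op p v" for c v
    by (induction p) (simp_all add: scale_right_distrib T.scale mult.commute)
  ultimately show ?thesis by unfold_locales
qed

lemma poly_op_commute: "poly_op p (T v) = T (poly_op p v)"
  by (induction p) (simp_all add: T.add T.scale)

lemma poly_op_closed:
  assumes "subspace V" "T ` V \<subseteq> V" "v \<in> V"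
  shows "poly_op p v \<in> V"
  using assms by (induction p) (auto intro: subspace_0 subspace_add subspace_scale)

lemma poly_op_linear_poly: "Vector_Spaces.linear smult scale (\<lambda>p. poly_op p v)"
proof -
  interpret P: vector_space "smult :: 'a \<Rightarrow> 'a poly \<Rightarrow> 'a poly" by (rule vector_space_smult)
  show ?thesis by unfold_locales (simp_all add: poly_op_add poly_op_smult)
qed

text \<open>Otherwise the linear map from \<open>p\<close> to \<open>poly_op p v\<close> would be
  injective modulo \<open>B\<close>. As \<open>V\<close> is finite dimensional modulo
  \<open>B\<close>, a finite set would then span all polynomials.\<close>

lemma annihilating_poly_vector:
  assumes V: "subspace V" "T ` V \<subseteq> V" and B: "subspace B"
    and S: "finite S" "V \<subseteq> span (S \<union> B)" and v: "v \<in> V"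
  shows "\<exists>p. p \<noteq> 0 \<and> poly_op p v \<in> B"
proof (rule ccontr)
  assume none: "\<nexists>p. p \<noteq> 0 \<and> poly_op p v \<in> B"
  interpret L: Vector_Spaces.linear smult scale "\<lambda>p. poly_op p v" by (rule poly_op_linear_poly)
  have "(\<lambda>p. poly_op p v) ` UNIV \<subseteq> span (S \<union> B)"
    using S(2) poly_op_closed[OF V v] by blast
  then obtain S' where S': "finite S'"
      "UNIV \<subseteq> L.vs1.span (S' \<union> {p \<in> UNIV. poly_op p v \<in> span B})"
    using L.finite_span_vimage[OF S(1) L.vs1.subspace_UNIV, of B] by auto
  have "{p \<in> UNIV. poly_op p v \<in> span B} \<subseteq> {0}"
    using none B by (auto simp: span_eq_iff[THEN iffD2])
  then have "finite (S' \<union> {p \<in> UNIV. poly_op p v \<in> span B})"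
    using S'(1) finite_subset by blast
  from UNIV_poly_not_finite_span[OF this] S'(2) show False by blast
qed

text \<open>The product of annihilating polynomials for finitely many generators works for all of
  them: polynomials in \<open>T\<close> commute, so any factor can be applied first.\<close>

lemma annihilating_poly:
  assumes V: "subspace V" "T ` V \<subseteq> V" and B: "subspace B" "T ` B \<subseteq> B" "B \<subseteq> V"
    and S: "finite S" "V \<subseteq> span (S \<union> B)"
  shows "\<exists>p. p \<noteq> 0 \<and> (\<forall>v\<in>V. poly_op p v \<in> B)"
proof -
  have B': "{v \<in> V. v \<in> span B} = B"
    using B by (auto simp: span_eq_iff[THEN iffD2])
  have "(\<lambda>v. v) ` V \<subseteq> span (S \<union> B)" using S(2) by simp
  from linear.finite_span_vimage[OF linear_ident S(1) V(1) this]
  obtain S' where S': "finite S'" "S' \<subseteq> V" "V \<subseteq> span (S' \<union> B)"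
    unfolding B' by blast
  have "\<exists>p. p \<noteq> 0 \<and> (\<forall>v\<in>S'. poly_op p v \<in> B)"
    using S'(1,2)
  proof (induction S' rule: finite_induct)
    case empty
    show ?case by (intro exI[of _ 1]) simp
  next
    case (insert s F)
    then obtain p where p: "p \<noteq> 0" "\<forall>v\<in>F. poly_op p v \<in> B" by auto
    obtain q where q: "q \<noteq> 0" "poly_op q s \<in> B"
      using annihilating_poly_vector[OF V B(1) S] insert.prems by blast
    have "poly_op (p * q) s \<in> B"
      using poly_op_closed[OF B(1,2) q(2)] by (simp add: poly_op_mult)
    moreover have "poly_op (p * q) v \<in> B" if "v \<in> F" for v
      using poly_op_closed[OF B(1,2)] p(2) that
      by (simp add: mult.commute[of p q] poly_op_mult)
    ultimately show ?case using p q by (intro exI[of _ "p * q"]) auto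
  qed
  then obtain p where p: "p \<noteq> 0" "\<forall>v\<in>S'. poly_op p v \<in> B" by blast
  interpret p: Vector_Spaces.linear scale scale "poly_op p" by (rule poly_op_linear)
  have "subspace {v. poly_op p v \<in> B}"
    by (rule subspaceI)
      (simp_all add: p.add p.scale p.zero subspace_0[OF B(1)] subspace_add[OF B(1)] subspace_scale[OF B(1)])
  moreover have "S' \<union> B \<subseteq> {v. poly_op p v \<in> B}"
    using p(2) poly_op_closed[OF B(1,2)] by blast
  ultimately have "span (S' \<union> B) \<subseteq> {v. poly_op p v \<in> B}" by (rule span_minimal[rotated])
  with S'(3) p(1) show ?thesis by blast
qed

text \<open>The two clauses say, without forming a quotient space, that \<open>T - c\<close> is
  injective and surjective on \<open>V\<close> modulo \<open>B\<close>. If \<open>p\<close>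
  annihilates this quotient and \<open>p = (x - c) q + p(c)\<close>, then
  \<open>- q(T) / p(c)\<close> inverts \<open>T - c\<close> there, so only roots of \<open>p\<close>
  are exceptional.\<close>

theorem bijective_mod_except_finite:
  assumes V: "subspace V" "T ` V \<subseteq> V" and B: "subspace B" "T ` B \<subseteq> B" "B \<subseteq> V"
    and S: "finite S" "V \<subseteq> span (S \<union> B)"
  shows "\<exists>\<Lambda>. finite \<Lambda> \<and> (\<forall>c. c \<notin> \<Lambda> \<longrightarrow>
    (\<forall>z\<in>V. T z - c *s z \<in> B \<longrightarrow> z \<in> B) \<and> (\<forall>z\<in>V. \<exists>y\<in>V. z - (T y - c *s y) \<in> B))"
proof -
  obtain p where p: "p \<noteq> 0" "\<And>v. v \<in> V \<Longrightarrow> poly_op p v \<in> B"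
    using annihilating_poly[OF assms] by blast
  show ?thesis
  proof (intro exI conjI allI impI)
    show "finite {c. poly p c = 0}" using p(1) by (rule poly_roots_finite)
  next
    fix c assume "c \<notin> {c. poly p c = 0}"
    then have c: "poly p c \<noteq> 0" by simp
    define q where "q = synthetic_div p c"
    interpret q: Vector_Spaces.linear scale scale "poly_op q" by (rule poly_op_linear)
    have "poly_op p v = poly_op ([:-c, 1:] * q + [:poly p c:]) v" for v
      unfolding q_def by (simp only: synthetic_div_correct')
    then have division: "poly_op p v = (T (poly_op q v) - c *s poly_op q v) + poly p c *s v" for v
      by (simp add: poly_op_add poly_op_diff poly_op_smult T.zero)
    have cancel: "v \<in> B" if "poly p c *s v \<in> B" for v
      using subspace_scale[OF B(1) that, of "inverse (poly p c)"] c by simp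
    show "\<forall>z\<in>V. T z - c *s z \<in> B \<longrightarrow> z \<in> B"
    proof (intro ballI impI)
      fix z assume z: "z \<in> V" "T z - c *s z \<in> B"
      have "T (poly_op q z) - c *s poly_op q z = poly_op q (T z - c *s z)"
        by (simp add: q.diff q.scale poly_op_commute)
      also have "\<dots> \<in> B" using z by (intro poly_op_closed[OF B(1,2)])
      finally have "poly_op p z - (T (poly_op q z) - c *s poly_op q z) \<in> B"
        by (rule subspace_diff[OF B(1) p(2)[OF z(1)]])
      then have "poly p c *s z \<in> B" by (simp add: division)
      then show "z \<in> B" by (rule cancel)
    qed
    show "\<forall>z\<in>V. \<exists>y\<in>V. z - (T y - c *s y) \<in> B"
    proof
      fix z assume z: "z \<in> V"
      define y where "y = (- inverse (poly p c)) *s poly_op q z"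
      have "y \<in> V" unfolding y_def by (intro subspace_scale[OF V(1)] poly_op_closed[OF V] z)
      moreover have "z - (T y - c *s y) = inverse (poly p c) *s poly_op p z"
        using c by (simp add: y_def division T.scale T.neg scale_right_distrib scale_right_diff_distrib
            algebra_simps)
      ultimately show "\<exists>y\<in>V. z - (T y - c *s y) \<in> B"
        using subspace_scale[OF B(1) p(2)[OF z]] by metis
    qed
  qed
qed

end

section \<open>The cohomology of the eigenspace of an operator on a complex\<close>

text \<open>Surjectivity of \<open>T - c\<close> gives a short exact sequence
  \<open>0 -> E -> K -> K -> 0\<close> of ungraded complexes, \<open>E\<close> being the eigenspace
  defined below. The lemmas are pieces of its long exact sequence, in terms of elements.\<close>

locale complex_with_operator = vector_space scale +
  d: Vector_Spaces.linear scale scale d + T: Vector_Spaces.linear scale scale T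
  for scale :: "'a::field \<Rightarrow> 'b::ab_group_add \<Rightarrow> 'b" (infixr \<open>*s\<close> 75) and d T +
  fixes K :: "'b set" and c :: 'a
  assumes K: "subspace K" "d ` K \<subseteq> K" "T ` K \<subseteq> K"
    and dd: "d (d x) = 0" and dT: "T (d x) = d (T x)"
    and surj: "\<And>w. w \<in> K \<Longrightarrow> \<exists>v\<in>K. T v - c *s v = w"
begin

definition "Z = {f \<in> K. d f = 0}"
definition "E = {f \<in> K. T f = c *s f}"
definition "ZE = {f \<in> E. d f = 0}"

text \<open>Subtracting a suitable \<open>d v\<close> moves \<open>u\<close> into \<open>E\<close>
  without changing \<open>d u\<close>. In other words, the connecting map, from the class of
  \<open>T u - c *s u\<close> to that of \<open>d u\<close>, is well defined.\<close>

lemma lift: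
  assumes "u \<in> K" "T u - c *s u \<in> d ` K"
  shows "d u \<in> d ` E"
proof -
  obtain w where w: "w \<in> K" "T u - c *s u = d w" using assms by blast
  obtain v where v: "v \<in> K" "T v - c *s v = w" using surj w by blast
  have "T (u - d v) - c *s (u - d v) = (T u - c *s u) - d (T v - c *s v)"
    by (simp add: T.diff d.diff d.scale dT scale_right_diff_distrib)
  also have "\<dots> = 0" using v w by simp
  finally have "u - d v \<in> E"
    unfolding E_def using assms(1) v(1) K(1,2) by (auto intro!: subspace_diff)
  moreover have "d (u - d v) = d u" by (simp add: d.diff dd)
  ultimately show ?thesis by (metis imageI)
qed

text \<open>Injectivity on cohomology gives a primitive \<open>u \<in> K\<close> of
  \<open>f\<close>. Surjectivity gives a cocycle \<open>z\<close> such that \<open>lift\<close>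
  applies to \<open>u - z\<close>, which has the same boundary.\<close>

lemma eigenspace_exact:
  assumes inj: "\<forall>z\<in>Z. T z - c *s z \<in> d ` K \<longrightarrow> z \<in> d ` K"
    and sur: "\<forall>z\<in>Z. \<exists>y\<in>Z. z - (T y - c *s y) \<in> d ` K"
  shows "ZE \<subseteq> d ` E"
proof
  fix f assume f: "f \<in> ZE"
  have "0 \<in> d ` K" using subspace_0[OF K(1)] by (metis d.zero imageI)
  then have "f \<in> d ` K" using f inj by (auto simp: ZE_def E_def Z_def)
  then obtain u where u: "u \<in> K" "f = d u" by blast
  have "T u - c *s u \<in> Z"
    using u f K by (auto simp: Z_def ZE_def E_def d.diff d.scale dT[symmetric]
        intro!: subspace_diff subspace_scale)
  then obtain z where z: "z \<in> Z" "T u - c *s u - (T z - c *s z) \<in> d ` K"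
    using sur by blast
  have "T (u - z) - c *s (u - z) = T u - c *s u - (T z - c *s z)"
    by (simp add: T.diff scale_right_diff_distrib)
  then have "d (u - z) \<in> d ` E"
    using u z K(1) by (intro lift) (auto simp: Z_def intro!: subspace_diff)
  then show "f \<in> d ` E" using u z by (simp add: d.diff Z_def)
qed

text \<open>The cohomology of \<open>E\<close> is an extension of a subspace of the cohomology of
  \<open>K\<close> by the image of the connecting map. Below, \<open>S1\<close> accounts for that
  image and \<open>S2\<close> for the subspace.\<close>

lemma eigenspace_finite_span:
  assumes S: "finite S" "Z \<subseteq> span (S \<union> d ` K)"
  shows "\<exists>S'. finite S' \<and> ZE \<subseteq> span (S' \<union> d ` E)"
proof -
  define D where "D = (\<lambda>v. T v - c *s v)"
  have D: "Vector_Spaces.linear scale scale D"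
    unfolding D_def by unfold_locales
      (simp_all add: T.add T.scale scale_right_distrib scale_right_diff_distrib mult.commute)
  have dD: "D (d x) = d (D x)" for x
    by (simp add: D_def dT d.diff d.scale)
  have D0: "D 0 = 0" by (simp add: D_def T.zero)
  have Dadd: "D (x + y) = D x + D y" for x y
    by (simp add: D_def T.add scale_right_distrib)
  have Dscale: "D (a *s x) = a *s D x" for a x
    by (simp add: D_def T.scale scale_right_diff_distrib mult.commute)
  \<comment> \<open>These are the \<open>u \<in> K\<close> with \<open>d u \<in> E\<close>. On them
    \<open>D u\<close> is a cocycle, and the connecting map takes its class to that of
    \<open>d u\<close>.\<close>
  define P where "P = {u \<in> K. D (d u) = 0}"
  have B: "subspace (d ` K)" using K(1) by (rule d.subspace_image)
  have spanB: "span (d ` K) = d ` K" using B by (rule span_eq_iff[THEN iffD2])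
  have P: "subspace P"
    unfolding P_def by (rule subspaceI)
      (simp_all add: subspace_0[OF K(1)] subspace_add[OF K(1)] subspace_scale[OF K(1)]
        d.zero d.add d.scale D0 Dadd Dscale)
  have ZE: "subspace ZE"
    unfolding ZE_def E_def by (rule subspaceI)
      (simp_all add: subspace_0[OF K(1)] subspace_add[OF K(1)] subspace_scale[OF K(1)]
        d.zero d.add d.scale T.zero T.add T.scale scale_right_distrib mult.commute)
  have DK: "D u \<in> K" if "u \<in> K" for u
    unfolding D_def using that K by (auto intro!: subspace_diff subspace_scale)
  have "D ` P \<subseteq> span (S \<union> d ` K)"
    using S(2) DK by (auto simp: P_def Z_def dD)
  from linear.finite_span_vimage[OF D S(1) P this]
  obtain S1 where S1: "finite S1" "P \<subseteq> span (S1 \<union> {u \<in> P. D u \<in> d ` K})"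
    unfolding spanB by blast
  have dP: "d ` P \<subseteq> span (d ` S1 \<union> d ` E)"
  proof -
    have "d ` P \<subseteq> d ` span (S1 \<union> {u \<in> P. D u \<in> d ` K})" using S1(2) by blast
    also have "\<dots> = span (d ` (S1 \<union> {u \<in> P. D u \<in> d ` K}))" by (simp add: d.span_image)
    \<comment> \<open>By \<open>lift\<close>, those \<open>u\<close> for which \<open>D u\<close> is
      a coboundary contribute only coboundaries of \<open>E\<close>.\<close>
    also have "\<dots> \<subseteq> span (d ` S1 \<union> d ` E)"
      using lift by (intro span_mono) (auto simp: P_def D_def)
    finally show ?thesis .
  qed
  have "(\<lambda>v. v) ` ZE \<subseteq> span (S \<union> d ` K)"
    using S(2) by (auto simp: ZE_def Z_def E_def)
  from linear.finite_span_vimage[OF linear_ident S(1) ZE this]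
  obtain S2 where S2: "finite S2" "ZE \<subseteq> span (S2 \<union> {v \<in> ZE. v \<in> d ` K})"
    unfolding spanB by blast
  \<comment> \<open>Any primitive in \<open>K\<close> of a cocycle of \<open>E\<close> belongs to
    \<open>P\<close>.\<close>
  have "{v \<in> ZE. v \<in> d ` K} \<subseteq> d ` P"
    by (auto simp: ZE_def E_def P_def D_def)
  then have "S2 \<union> {v \<in> ZE. v \<in> d ` K} \<subseteq> span ((S2 \<union> d ` S1) \<union> d ` E)"
    using dP span_mono[of "d ` S1 \<union> d ` E" "(S2 \<union> d ` S1) \<union> d ` E"]
    by (auto intro: span_base)
  from span_minimal[OF this subspace_span] have "ZE \<subseteq> span ((S2 \<union> d ` S1) \<union> d ` E)"
    using S2(2) by blast
  then show ?thesis using S1(1) S2(1) by (intro exI[of _ "S2 \<union> d ` S1"]) auto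
qed

end

section \<open>Equivariant homogeneous cochains\<close>

definition fscale :: "complex \<Rightarrow> ('x \<Rightarrow> complex) \<Rightarrow> 'x \<Rightarrow> complex" where
  "fscale c f = (\<lambda>x. c * f x)"

lemma sum_fun_apply: "sum F A x = (\<Sum>a\<in>A. F a x)"
  by (induction A rule: infinite_finite_induct) (simp_all add: plus_fun_def)

global_interpretation fs: vector_space fscale
  by unfold_locales (auto simp: fscale_def plus_fun_def algebra_simps)

text \<open>The alternating sum over all deletions of one entry, on lists of all lengths at once.\<close>

fun cobd :: "('a list \<Rightarrow> complex) \<Rightarrow> 'a list \<Rightarrow> complex" where
  "cobd f [] = 0"
| "cobd f (a # x) = f x - cobd (\<lambda>y. f (a # y)) x"

lemma cobd_add: "cobd (\<lambda>y. f y + g y) x = cobd f x + cobd g x"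
proof (induction x arbitrary: f g)
  case (Cons a x)
  show ?case using Cons[of "\<lambda>y. f (a # y)" "\<lambda>y. g (a # y)"] by simp
qed simp

lemma cobd_scale: "cobd (\<lambda>y. c * f y) x = c * cobd f x"
proof (induction x arbitrary: f)
  case (Cons a x)
  show ?case using Cons[of "\<lambda>y. f (a # y)"] by (simp add: algebra_simps)
qed simp

lemma linear_cobd: "Vector_Spaces.linear fscale fscale cobd"
  by unfold_locales (auto simp: fun_eq_iff cobd_add plus_fun_def cobd_scale fscale_def)

global_interpretation cobd: Vector_Spaces.linear fscale fscale cobd
  by (rule linear_cobd)

lemma cobd_diff: "cobd (\<lambda>y. f y - g y) x = cobd f x - cobd g x"
  using fun_cong[OF cobd.diff[of f g], of x] by (simp add: fun_diff_def)

text \<open>After the leading entry is expanded, the two copies of \<open>cobd f x\<close> cancel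
  and the claim for \<open>\<lambda>y. f (a # y)\<close> remains; hence the induction over arbitrary
  \<open>f\<close>.\<close>

lemma cobd_cobd: "cobd (cobd f) = 0"
proof
  show "cobd (cobd f) x = 0 x" for x
  proof (induction x arbitrary: f)
    case (Cons a x)
    show ?case using Cons[of "\<lambda>y. f (a # y)"] by (simp add: cobd_diff)
  qed simp
qed

lemma cobd_map: "cobd f (map g x) = cobd (\<lambda>y. f (map g y)) x"
proof (induction x arbitrary: f)
  case (Cons a x)
  show ?case using Cons[of "\<lambda>y. f (g a # y)"] by simp
qed simp

context group
begin

text \<open>Elements outside the carrier are treated as the unit, so that equivariant functions on
  lists are determined by their values on lists over the carrier.\<close>

definition act :: "'a \<Rightarrow> 'a \<Rightarrow> 'a" where
  "act h y = h \<otimes> (if y \<in> carrier G then y else \<one>)"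

lemma act_closed [simp]: "h \<in> carrier G \<Longrightarrow> act h y \<in> carrier G"
  by (simp add: act_def)

lemma act_act [simp]:
  "g \<in> carrier G \<Longrightarrow> h \<in> carrier G \<Longrightarrow> act g (act h y) = act (g \<otimes> h) y"
  by (auto simp: act_def m_assoc)

lemma act_comp [simp]: "g \<in> carrier G \<Longrightarrow> h \<in> carrier G \<Longrightarrow> act g \<circ> act h = act (g \<otimes> h)"
  by (simp add: fun_eq_iff)

text \<open>The nonempty lists over \<open>G\<close> span a resolution that is free over every
  subgroup \<open>N\<close>, so for a character \<open>\<chi>\<close> these functions compute the
  cohomology of \<open>N\<close> with coefficients twisted by \<open>\<chi>\<close>, in all degrees
  together. The condition \<open>f [] = 0\<close> cuts off the augmentation, which would distort
  degree zero.\<close>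

definition cochains :: "'a set \<Rightarrow> ('a \<Rightarrow> complex) \<Rightarrow> ('a list \<Rightarrow> complex) set" where
  "cochains N \<chi> = {f. f [] = 0 \<and> (\<forall>h\<in>N. \<forall>x. f (map (act h) x) = \<chi> h * f x)}"

definition cocycles :: "'a set \<Rightarrow> ('a \<Rightarrow> complex) \<Rightarrow> ('a list \<Rightarrow> complex) set" where
  "cocycles N \<chi> = {f \<in> cochains N \<chi>. cobd f = 0}"

definition coboundaries :: "'a set \<Rightarrow> ('a \<Rightarrow> complex) \<Rightarrow> ('a list \<Rightarrow> complex) set" where
  "coboundaries N \<chi> = cobd ` cochains N \<chi>"

lemma subspace_cochains: "fs.subspace (cochains N \<chi>)"
  by (rule fs.subspaceI) (auto simp: cochains_def plus_fun_def fscale_def algebra_simps)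

lemma cobd_cochains: "f \<in> cochains N \<chi> \<Longrightarrow> cobd f \<in> cochains N \<chi>"
proof -
  assume f: "f \<in> cochains N \<chi>"
  have "cobd f (map (act h) x) = \<chi> h * cobd f x" if "h \<in> N" for h x
  proof -
    have "(\<lambda>y. f (map (act h) y)) = (\<lambda>y. \<chi> h * f y)"
      using f that by (auto simp: cochains_def)
    then show ?thesis by (simp add: cobd_map cobd_scale)
  qed
  then show ?thesis by (simp add: cochains_def)
qed

lemma subspace_cocycles: "fs.subspace (cocycles N \<chi>)"
  unfolding cocycles_def using subspace_cochains[of N \<chi>]
  by (intro fs.subspaceI)
    (auto simp: cobd.zero cobd.add cobd.scale fs.subspace_0 fs.subspace_add fs.subspace_scale)

lemma subspace_coboundaries: "fs.subspace (coboundaries N \<chi>)"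
  unfolding coboundaries_def by (rule cobd.subspace_image[OF subspace_cochains])

lemma coboundaries_subset: "coboundaries N \<chi> \<subseteq> cocycles N \<chi>"
  by (auto simp: coboundaries_def cocycles_def cobd_cochains cobd_cobd)

lemma cochains_mono: "M \<subseteq> N \<Longrightarrow> cochains N \<chi> \<subseteq> cochains M \<chi>"
  by (auto simp: cochains_def)

lemma cochains_cong: "(\<And>h. h \<in> N \<Longrightarrow> \<chi> h = \<psi> h) \<Longrightarrow> cochains N \<chi> = cochains N \<psi>"
  by (simp add: cochains_def)

section \<open>Characters of subgroups\<close>

abbreviation "chars N \<equiv> char_torus (G\<lparr>carrier := N\<rparr>)"

definition acyclic_cochains :: "'a set \<Rightarrow> ('a \<Rightarrow> complex) \<Rightarrow> bool" where
  "acyclic_cochains N \<chi> \<longleftrightarrow> cocycles N \<chi> \<subseteq> coboundaries N \<chi>"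

text \<open>With the degrees lumped together, the first clause bounds the total cohomology and the
  second covers characters exceptional in any degree. Finite dimension is propagated because it
  bounds the exceptional values of \<open>\<chi> t\<close> in an infinite cyclic extension.\<close>

definition finite_cohomology :: "'a set \<Rightarrow> bool" where
  "finite_cohomology N \<longleftrightarrow>
    (\<forall>\<chi>\<in>chars N. \<exists>S. finite S \<and> cocycles N \<chi> \<subseteq> fs.span (S \<union> coboundaries N \<chi>)) \<and>
    finite {\<chi> \<in> chars N. \<not> acyclic_cochains N \<chi>}"

lemma char_mult: "\<chi> \<in> chars N \<Longrightarrow> g \<in> N \<Longrightarrow> h \<in> N \<Longrightarrow> \<chi> (g \<otimes> h) = \<chi> g * \<chi> h"
  and char_nonzero: "\<chi> \<in> chars N \<Longrightarrow> g \<in> N \<Longrightarrow> \<chi> g \<noteq> 0"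
  by (auto simp: char_torus_def)

lemma char_one: "subgroup N G \<Longrightarrow> \<chi> \<in> chars N \<Longrightarrow> \<chi> \<one> = 1"
  using char_mult[of \<chi> N \<one> \<one>] char_nonzero[of \<chi> N \<one>] subgroup.one_closed[of N G] by simp

lemma char_inv:
  assumes "subgroup N G" "\<chi> \<in> chars N" "g \<in> N"
  shows "\<chi> (inv g) = inverse (\<chi> g)"
proof -
  have "\<chi> (inv g) * \<chi> g = 1"
    using assms by (simp add: char_mult[symmetric] subgroup.m_inv_closed char_one
        subgroup.mem_carrier)
  then show ?thesis using char_nonzero[OF assms(2,3)] by (simp add: field_simps)
qed

lemma char_pow:
  fixes n :: nat
  assumes "subgroup N G" "\<chi> \<in> chars N" "g \<in> N"
  shows "\<chi> (g [^] n) = \<chi> g ^ n"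
proof (induction n)
  case (Suc n)
  have "g [^] n \<in> N"
    using assms subgroup_int_pow_closed[of N g "int n"] by (simp add: int_pow_int)
  then show ?case using Suc assms by (simp add: char_mult)
qed (simp add: char_one[OF assms(1,2)])

lemma restrict_char: "M \<subseteq> N \<Longrightarrow> subgroup M G \<Longrightarrow> \<chi> \<in> chars N \<Longrightarrow> restrict \<chi> M \<in> chars M"
  by (auto simp: char_torus_def subgroup.m_closed)

lemma restrict_cochains: "cochains M (restrict \<chi> M) = cochains M \<chi>"
  by (intro cochains_cong) simp

lemma restrict_cocycles: "cocycles M (restrict \<chi> M) = cocycles M \<chi>"
  and restrict_coboundaries: "coboundaries M (restrict \<chi> M) = coboundaries M \<chi>"
  and restrict_acyclic: "acyclic_cochains M (restrict \<chi> M) = acyclic_cochains M \<chi>"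
  by (simp_all add: cocycles_def coboundaries_def acyclic_cochains_def restrict_cochains)

lemma char_eqI:
  assumes N: "subgroup N G" "N = generate G A" and A: "A \<subseteq> carrier G"
    and \<chi>: "\<chi> \<in> chars N" and \<psi>: "\<psi> \<in> chars N" and eq: "\<And>a. a \<in> A \<Longrightarrow> \<chi> a = \<psi> a"
  shows "\<chi> = \<psi>"
proof
  fix x
  show "\<chi> x = \<psi> x"
  proof (cases "x \<in> N")
    case True
    then have "x \<in> generate G A" using N(2) by simp
    then show ?thesis
    proof (induction rule: generate.induct)
      case one
      then show ?case using N(1) \<chi> \<psi> by (simp add: char_one)
    next
      case (incl h)
      then show ?case by (rule eq)
    next
      case (inv h)
      moreover have "h \<in> N" using inv N(2) by (simp add: generate.incl)
      ultimately show ?case using N(1) \<chi> \<psi> eq by (simp add: char_inv)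
    next
      case (eng h1 h2)
      then show ?case using N(2) \<chi> \<psi> by (simp add: char_mult)
    qed
  next
    case False
    then show ?thesis using \<chi> \<psi> by (auto simp: char_torus_def extensional_def)
  qed
qed

text \<open>A character of \<open>N\<close> is determined by its restriction to \<open>M\<close> and
  its values on \<open>S\<close>, so the set embeds into a finite union of finite products. The
  values allowed at \<open>s\<close> may depend on the restriction.\<close>

lemma finite_chars:
  assumes N: "subgroup N G" "N = generate G (M \<union> S)" and sub: "M \<union> S \<subseteq> carrier G"
    and fin: "finite S" "finite X" "\<And>s \<phi>. s \<in> S \<Longrightarrow> \<phi> \<in> X \<Longrightarrow> finite (F \<phi> s)"
  shows "finite {\<chi> \<in> chars N. restrict \<chi> M \<in> X \<and> (\<forall>s\<in>S. \<chi> s \<in> F (restrict \<chi> M) s)}"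
    (is "finite ?C")
proof (rule inj_on_finite)
  show "inj_on (\<lambda>\<chi>. (restrict \<chi> M, restrict \<chi> S)) ?C"
  proof (rule inj_onI)
    fix \<chi> \<psi> assume *: "\<chi> \<in> ?C" "\<psi> \<in> ?C" "(restrict \<chi> M, restrict \<chi> S) = (restrict \<psi> M, restrict \<psi> S)"
    then have "\<chi> a = \<psi> a" if "a \<in> M \<union> S" for a
      using that by (metis Pair_inject UnE restrict_apply')
    then show "\<chi> = \<psi>" using char_eqI[OF N sub] * by blast
  qed
  show "(\<lambda>\<chi>. (restrict \<chi> M, restrict \<chi> S)) ` ?C \<subseteq> (SIGMA \<phi>:X. Pi\<^sub>E S (F \<phi>))"
    by (auto simp: PiE_def)
  show "finite (SIGMA \<phi>:X. Pi\<^sub>E S (F \<phi>))"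
    using fin by (intro finite_SigmaI finite_PiE) auto
qed

section \<open>The trivial subgroup\<close>

text \<open>Prepending \<open>\<one>\<close> is a contracting homotopy: the cocycle condition at
  \<open>\<one> # x\<close> reads \<open>f x = cobd u x\<close>. The assumption on
  \<open>f [\<one>]\<close> is what makes \<open>u [] = 0\<close>.\<close>

lemma trivial_cocycle_coboundary:
  assumes f: "f \<in> cocycles {\<one>} \<chi>" "f [\<one>] = 0"
  shows "f \<in> coboundaries {\<one>} \<chi>"
proof -
  define u where "u = (\<lambda>x. f (\<one> # x))"
  have "u (map (act \<one>) x) = \<chi> \<one> * u x" for x
  proof -
    have "u (map (act \<one>) x) = f (map (act \<one>) (\<one> # x))" by (simp add: u_def act_def)
    also have "\<dots> = \<chi> \<one> * f (\<one> # x)"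
      using f(1) unfolding cocycles_def cochains_def by blast
    finally show ?thesis by (simp add: u_def)
  qed
  then have "u \<in> cochains {\<one>} \<chi>" using f(2) by (simp add: cochains_def u_def)
  moreover have "f = cobd u"
  proof
    fix x
    have "cobd f (\<one> # x) = 0" using f(1) by (simp add: cocycles_def)
    then show "f x = cobd u x" by (simp add: u_def)
  qed
  ultimately show ?thesis by (simp add: coboundaries_def)
qed

text \<open>There is only one character, and the value at \<open>[\<one>]\<close> is the only
  obstruction to being a coboundary, so the cohomology is at most one-dimensional.\<close>

lemma finite_cohomology_trivial: "finite_cohomology {\<one>}"
proof -
  have "{\<chi> \<in> chars {\<one>}. \<not> acyclic_cochains {\<one>} \<chi>} \<subseteq> {restrict (\<lambda>_. 1) {\<one>}}"
    using char_one[OF triv_subgroup] by (auto simp: char_torus_def extensional_def)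
  moreover have "\<exists>S. finite S \<and> cocycles {\<one>} \<chi> \<subseteq> fs.span (S \<union> coboundaries {\<one>} \<chi>)" for \<chi>
  proof (cases "\<forall>f\<in>cocycles {\<one>} \<chi>. f [\<one>] = 0")
    case True
    then show ?thesis
      using trivial_cocycle_coboundary by (intro exI[of _ "{}"]) (auto intro: fs.span_base)
  next
    case False
    then obtain f0 where f0: "f0 \<in> cocycles {\<one>} \<chi>" "f0 [\<one>] \<noteq> 0" by blast
    have "f \<in> fs.span (insert f0 (coboundaries {\<one>} \<chi>))" if f: "f \<in> cocycles {\<one>} \<chi>" for f
    proof -
      let ?g = "f - fscale (f [\<one>] / f0 [\<one>]) f0"
      have "?g \<in> cocycles {\<one>} \<chi>"
        by (intro fs.subspace_diff fs.subspace_scale subspace_cocycles f f0)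
      moreover have "?g [\<one>] = 0" using f0(2) by (simp add: fun_diff_def fscale_def)
      ultimately have "?g \<in> fs.span (coboundaries {\<one>} \<chi>)"
        by (intro fs.span_base trivial_cocycle_coboundary)
      then show ?thesis by (auto simp: fs.span_insert)
    qed
    then show ?thesis by (intro exI[of _ "{f0}"]) auto
  qed
  ultimately show ?thesis unfolding finite_cohomology_def using finite_subset by blast
qed

section \<open>Infinite cyclic quotients\<close>

text \<open>Write \<open>h m\<close> as \<open>(h m h^-1) h\<close>. The bracket lies in
  \<open>M\<close>, and \<open>\<chi>\<close> takes the same value on it as on \<open>m\<close>
  because it is a character of all of \<open>N\<close>.\<close>

lemma cochains_translate:
  assumes N: "subgroup N G" and MN: "M \<subseteq> N" and \<chi>: "\<chi> \<in> chars N"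
    and conj: "\<And>m. m \<in> M \<Longrightarrow> h \<otimes> m \<otimes> inv h \<in> M"
    and h: "h \<in> N" and f: "f \<in> cochains M \<chi>"
  shows "(\<lambda>x. f (map (act h) x)) \<in> cochains M \<chi>"
proof -
  have "f (map (act h) (map (act m) x)) = \<chi> m * f (map (act h) x)" if m: "m \<in> M" for m x
  proof -
    have mem: "m \<in> N" "m \<in> carrier G" "h \<in> carrier G"
      using m h MN N by (auto dest: subgroup.mem_carrier)
    have "h \<otimes> m = (h \<otimes> m \<otimes> inv h) \<otimes> h" using mem by (simp add: m_assoc)
    then have "f (map (act h) (map (act m) x)) = f (map (act (h \<otimes> m \<otimes> inv h)) (map (act h) x))"
      using mem by simp
    also have "\<dots> = \<chi> (h \<otimes> m \<otimes> inv h) * f (map (act h) x)"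
      using f conj[OF m] unfolding cochains_def by blast
    also have "\<chi> (h \<otimes> m \<otimes> inv h) = \<chi> m"
      using N \<chi> h mem char_nonzero[OF \<chi> h]
      by (simp add: char_mult char_inv subgroup.m_closed subgroup.m_inv_closed)
    finally show ?thesis .
  qed
  then show ?thesis using f by (simp add: cochains_def)
qed

lemma generate_cyclic_quotient:
  assumes N: "subgroup N G" and MN: "M \<subseteq> N" and t: "t \<in> N"
    and cyclic: "\<And>h. h \<in> N \<Longrightarrow> \<exists>m\<in>M. \<exists>k::int. h = m \<otimes> t [^] k"
  shows "N = generate G (M \<union> {t})"
proof
  show "generate G (M \<union> {t}) \<subseteq> N" using MN t by (intro generate_subgroup_incl N) auto
  have gen: "subgroup (generate G (M \<union> {t})) G"
    using MN t subgroup.subset[OF N] by (intro generate_is_subgroup) auto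
  show "N \<subseteq> generate G (M \<union> {t})"
  proof
    fix h assume "h \<in> N"
    then obtain m and k :: int where "m \<in> M" "h = m \<otimes> t [^] k" using cyclic by blast
    moreover have "t [^] k \<in> generate G (M \<union> {t})"
      using gen by (intro subgroup_int_pow_closed) (auto intro: generate.incl)
    ultimately show "h \<in> generate G (M \<union> {t})" by (auto intro: generate.incl generate.eng)
  qed
qed

end

text \<open>The quotient of \<open>N\<close> by \<open>M\<close> is infinite cyclic with generator
  the class of \<open>t\<close>, phrased by elements of \<open>G\<close> alone.\<close>

locale infinite_cyclic_quotient = group G for G (structure) +
  fixes M N t
  assumes M: "subgroup M G" and N: "subgroup N G" and MN: "M \<subseteq> N"
    and conj: "\<And>h m. h \<in> N \<Longrightarrow> m \<in> M \<Longrightarrow> h \<otimes> m \<otimes> inv h \<in> M"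
    and t: "t \<in> N" and cyclic: "\<And>h. h \<in> N \<Longrightarrow> \<exists>m\<in>M. \<exists>k::int. h = m \<otimes> t [^] k"
    and infinite: "\<And>k::int. t [^] k \<in> M \<Longrightarrow> k = 0"
begin

lemma subset_carrier [simp]: "h \<in> N \<Longrightarrow> h \<in> carrier G" "m \<in> M \<Longrightarrow> m \<in> carrier G" "t \<in> carrier G"
  using N MN t by (auto dest: subgroup.mem_carrier)

lemma pow_mem [simp]: "t [^] (k::int) \<in> N"
  using N t by (rule subgroup_int_pow_closed)

lemma generate_N: "N = generate G (M \<union> {t})"
  by (rule generate_cyclic_quotient[OF N MN t cyclic])

text \<open>The projection of \<open>N\<close> onto its quotient by \<open>M\<close>, identified
  with the integers through \<open>t\<close>. The exponent exists by \<open>cyclic\<close> and is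
  unique by \<open>infinite\<close>.\<close>

definition lev :: "'a \<Rightarrow> int" where
  "lev h = (THE k. \<exists>m\<in>M. h = m \<otimes> t [^] k)"

lemma lev: "m \<in> M \<Longrightarrow> lev (m \<otimes> t [^] k) = k"
proof -
  assume m: "m \<in> M"
  have "l = k" if "m' \<in> M" "m \<otimes> t [^] k = m' \<otimes> t [^] l" for m' and l :: int
  proof -
    have "t [^] (l - k) = t [^] l \<otimes> inv (t [^] k)" by (simp add: int_pow_diff)
    also have "t [^] l = inv m' \<otimes> m \<otimes> t [^] k"
      using that m by (simp add: m_assoc inv_solve_left)
    also have "inv m' \<otimes> m \<otimes> t [^] k \<otimes> inv (t [^] k) = inv m' \<otimes> m"
      using that(1) m by (simp add: m_assoc)
    also have "\<dots> \<in> M" using that m M by (simp add: subgroup.m_closed subgroup.m_inv_closed)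
    finally show ?thesis using infinite by force
  qed
  then show ?thesis unfolding lev_def using m by (intro the_equality) blast+
qed

lemma lev_t: "h \<in> N \<Longrightarrow> lev (t \<otimes> h) = lev h + 1"
proof -
  assume "h \<in> N"
  then obtain m and k :: int where h: "m \<in> M" "h = m \<otimes> t [^] k" using cyclic by blast
  have "t \<otimes> h = (t \<otimes> m \<otimes> inv t) \<otimes> (t \<otimes> t [^] k)"
    using h(1) by (simp add: h(2) m_assoc flip: m_assoc[of "inv t" t])
  also have "t \<otimes> t [^] k = t [^] (1 + k)" by (subst int_pow_mult) (simp_all add: int_pow_1)
  finally show ?thesis using lev h conj[OF t h(1)] by simp
qed

lemma lev_M: "m \<in> M \<Longrightarrow> h \<in> N \<Longrightarrow> lev (m \<otimes> h) = lev h"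
proof -
  assume m: "m \<in> M" and "h \<in> N"
  then obtain m' and k :: int where h: "m' \<in> M" "h = m' \<otimes> t [^] k" using cyclic by blast
  then have "m \<otimes> h = (m \<otimes> m') \<otimes> t [^] k" using m by (simp add: m_assoc)
  then show ?thesis using lev h m M subgroup.m_closed by metis
qed

text \<open>Cochains live on lists over \<open>G\<close>, so \<open>lev\<close> has to be extended
  beyond \<open>N\<close>: in each right coset of \<open>N\<close> a chosen element plays the part
  of the unit. Foreign elements are first replaced by \<open>\<one>\<close>.\<close>

definition level :: "'a \<Rightarrow> int" where
  "level y = lev (act \<one> y \<otimes> inv (SOME z. z \<in> N #> act \<one> y))"

text \<open>Left multiplication by \<open>h \<in> N\<close> preserves the right coset of
  \<open>N\<close>, hence the chosen element \<open>z\<close>. The required element of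
  \<open>N\<close> is \<open>y z^-1\<close>.\<close>

lemma level_act:
  assumes h: "h \<in> N"
  shows "\<exists>n\<in>N. level y = lev n \<and> level (act h y) = lev (h \<otimes> n)"
proof -
  let ?y = "act \<one> y"
  define z where "z = (SOME z. z \<in> N #> ?y)"
  have y: "?y \<in> carrier G" by simp
  have "z \<in> N #> ?y" unfolding z_def using rcos_self[OF y N] by (rule someI)
  then obtain n where n: "n \<in> N" "z = n \<otimes> ?y" by (auto simp: r_coset_def)
  have "act \<one> (act h y) = act h y" using h by (simp add: act_def)
  also have "\<dots> = h \<otimes> ?y" using h by (auto simp: act_def)
  finally have hy: "act \<one> (act h y) = h \<otimes> ?y" .
  have NG: "N \<subseteq> carrier G" by auto
  have "N #> (h \<otimes> ?y) = N #> h #> ?y" using h NG y by (simp add: coset_mult_assoc)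
  also have "N #> h = N" using h N by (simp add: coset_join2)
  finally have coset: "N #> (h \<otimes> ?y) = N #> ?y" .
  have yz: "?y \<otimes> inv z = inv n"
    using n y by (simp add: inv_mult_group flip: m_assoc)
  have zc: "z \<in> carrier G" using n y by simp
  have 1: "level y = lev (inv n)" unfolding level_def by (fold z_def) (simp add: yz)
  have "level (act h y) = lev (h \<otimes> ?y \<otimes> inv z)"
    unfolding level_def hy coset by (fold z_def) simp
  also have "h \<otimes> ?y \<otimes> inv z = h \<otimes> inv n" using h y zc yz by (simp add: m_assoc)
  finally have "level (act h y) = lev (h \<otimes> inv n)" .
  with 1 show ?thesis using n(1) N subgroup.m_inv_closed by metis
qed

lemma level_t: "level (act t y) = level y + 1"
  using level_act[OF t, of y] lev_t by force

lemma level_M: "m \<in> M \<Longrightarrow> level (act m y) = level y"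
  using level_act[of m y] lev_M MN by force

text \<open>The unique solution that vanishes on lists whose first entry has level zero.\<close>

lemma translation_surj:
  assumes \<chi>: "\<chi> \<in> chars N" and w: "w \<in> cochains M \<chi>" and c: "c \<noteq> 0"
  shows "\<exists>v\<in>cochains M \<chi>. (\<lambda>x. v (map (act t) x)) - fscale c v = w"
proof -
  define W where "W = (\<lambda>(j::int) x. w (map (act (t [^] j)) x))"
  have W: "W j \<in> cochains M \<chi>" for j
    unfolding W_def by (rule cochains_translate[OF N MN \<chi> conj _ w]) simp_all
  have Wt: "W j (map (act t) x) = W (j + 1) x" for j x
  proof -
    have "t [^] (j + 1) = t [^] j \<otimes> t" by (simp add: int_pow_mult int_pow_1)
    then show ?thesis unfolding W_def by simp
  qed
  have W0: "W 0 x = w x" for x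
    using w M char_one[OF N \<chi>] subgroup.one_closed[OF M] by (simp add: W_def cochains_def)
  \<comment> \<open>The equation reads \<open>v (t x) = c * v x + w x\<close>. Starting with zero at
    level zero, it is solved upwards in the first branch and downwards, dividing by
    \<open>c\<close>, in the second.\<close>
  define v where "v = (\<lambda>x. if x = [] then 0 else
    if level (hd x) \<ge> 0 then \<Sum>j<nat (level (hd x)). c ^ j * W (- int (Suc j)) x
    else - (\<Sum>j<nat (- level (hd x)). inverse c ^ Suc j * W (int j) x))"
  have "v (map (act m) x) = \<chi> m * v x" if m: "m \<in> M" for m x
  proof (cases x)
    case (Cons a y)
    have WM: "W j (map (act m) x) = \<chi> m * W j x" for j
      using W m by (auto simp: cochains_def)
    have "level (hd (map (act m) x)) = level (hd x)" using Cons m by (simp add: level_M)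
    moreover have "map (act m) x \<noteq> []" "x \<noteq> []" using Cons by auto
    ultimately show ?thesis
      by (simp add: v_def WM sum_distrib_left mult.left_commute del: list.map)
  qed (simp add: v_def)
  then have "v \<in> cochains M \<chi>" by (simp add: cochains_def v_def)
  moreover have "v (map (act t) x) - c * v x = w x" for x
  proof (cases "x = []")
    case True
    then show ?thesis using w by (simp add: v_def cochains_def)
  next
    case False
    have hd: "level (hd (map (act t) x)) = level (hd x) + 1"
      using False by (simp add: hd_map level_t)
    show ?thesis
    proof (cases "level (hd x) \<ge> 0")
      case True
      define n where "n = nat (level (hd x))"
      have n: "nat (level (hd x) + 1) = Suc n" using True by (simp add: n_def)
      have "v (map (act t) x) = (\<Sum>j<Suc n. c ^ j * W (- int j) x)"
        using False True by (simp add: v_def hd n Wt)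
      also have "\<dots> = w x + c * (\<Sum>j<n. c ^ j * W (- int (Suc j)) x)"
        by (subst sum.lessThan_Suc_shift) (simp add: W0 sum_distrib_left mult.assoc)
      also have "(\<Sum>j<n. c ^ j * W (- int (Suc j)) x) = v x"
        using False True by (simp add: v_def n_def)
      finally show ?thesis by simp
    next
      case neg: False
      define n where "n = nat (- (level (hd x) + 1))"
      have n: "nat (- level (hd x)) = Suc n" using neg by (simp add: n_def)
      have "v (map (act t) x) = - (\<Sum>j<n. inverse c ^ Suc j * W (int (Suc j)) x)"
      \<comment> \<open>From level \<open>-1\<close> the translate enters the first branch of
        \<open>v\<close>, whose sum is empty at level zero.\<close>
      proof (cases "level (hd x) + 1 = 0")
        case True
        then show ?thesis using False by (simp add: v_def hd n_def)
      next
        case nz: False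
        then have "\<not> level (hd x) + 1 \<ge> 0" using neg by simp
        then show ?thesis using False by (simp add: v_def hd Wt n_def add.commute)
      qed
      moreover have "c * v x = - (\<Sum>j<Suc n. inverse c ^ j * W (int j) x)"
        using False neg c by (simp add: v_def n sum_distrib_left flip: mult.assoc del: sum.lessThan_Suc)
      moreover have "(\<Sum>j<Suc n. inverse c ^ j * W (int j) x)
          = w x + (\<Sum>j<n. inverse c ^ Suc j * W (int (Suc j)) x)"
        by (subst sum.lessThan_Suc_shift) (simp add: W0)
      ultimately show ?thesis by (simp del: sum.lessThan_Suc)
    qed
  qed
  then have "(\<lambda>x. v (map (act t) x)) - fscale c v = w"
    by (simp add: fun_eq_iff fun_diff_def fscale_def)
  ultimately show ?thesis by blast
qed

section \<open>Cochains of \<open>N\<close> as an eigenspace of translation by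
  \<open>t\<close>\<close>

definition T :: "('a list \<Rightarrow> complex) \<Rightarrow> 'a list \<Rightarrow> complex" where
  "T f = (\<lambda>x. f (map (act t) x))"

lemma linear_T: "Vector_Spaces.linear fscale fscale T"
  by unfold_locales (auto simp: T_def plus_fun_def fscale_def)

lemma T_cobd: "T (cobd f) = cobd (T f)"
  by (simp add: T_def cobd_map)

lemma T_cochains: "\<chi> \<in> chars N \<Longrightarrow> f \<in> cochains M \<chi> \<Longrightarrow> T f \<in> cochains M \<chi>"
  unfolding T_def by (rule cochains_translate[OF N MN _ conj t]) (simp_all add: t)

text \<open>Equivariance under \<open>M\<close> and \<open>t\<close> extends to the subgroup they
  generate, which is \<open>N\<close>.\<close>

lemma eigenspace:
  assumes \<chi>: "\<chi> \<in> chars N"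
  shows "{f \<in> cochains M \<chi>. T f = fscale (\<chi> t) f} = cochains N \<chi>"
proof
  show "cochains N \<chi> \<subseteq> {f \<in> cochains M \<chi>. T f = fscale (\<chi> t) f}"
    using cochains_mono[OF MN] t by (auto simp: cochains_def T_def fscale_def)
  show "{f \<in> cochains M \<chi>. T f = fscale (\<chi> t) f} \<subseteq> cochains N \<chi>"
  proof
    fix f assume "f \<in> {f \<in> cochains M \<chi>. T f = fscale (\<chi> t) f}"
    then have f: "f \<in> cochains M \<chi>" "f (map (act t) x) = \<chi> t * f x" for x
      by (auto simp: T_def fscale_def fun_eq_iff)
    have gen: "f (map (act h) x) = \<chi> h * f x" if "h \<in> M \<union> {t}" for h x
      using that f by (auto simp: cochains_def)
    have sub: "M \<union> {t} \<subseteq> N" using MN t by auto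
    have "f (map (act h) x) = \<chi> h * f x" if "h \<in> generate G (M \<union> {t})" for h x
      using that
    proof (induction arbitrary: x rule: generate.induct)
      case one
      then show ?case using gen[of \<one>] subgroup.one_closed[OF M] by simp
    next
      case (incl h)
      then show ?case by (rule gen)
    next
      case (inv h)
      then have h: "h \<in> N" using sub by blast
      \<comment> \<open>Equivariance under \<open>inv h\<close> is obtained by solving the rule for
        \<open>h\<close> at the translate by \<open>inv h\<close>.\<close>
      have "f x = f (map (act \<one>) x)"
        using gen[of \<one> x] subgroup.one_closed[OF M] char_one[OF N \<chi>] by simp
      also have "\<dots> = f (map (act h) (map (act (inv h)) x))" using h by simp
      also have "\<dots> = \<chi> h * f (map (act (inv h)) x)" using inv by (rule gen)
      finally show ?case using char_inv[OF N \<chi> h] char_nonzero[OF \<chi> h] by simp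
    next
      case (eng g h)
      then have gh: "g \<in> N" "h \<in> N" using generate_N by auto
      then have "f (map (act (g \<otimes> h)) x) = f (map (act g) (map (act h) x))" by simp
      also have "\<dots> = \<chi> g * (\<chi> h * f x)" using eng by metis
      finally show ?case using gh by (simp add: char_mult[OF \<chi>])
    qed
    then show "f \<in> cochains N \<chi>" using f(1) generate_N by (auto simp: cochains_def)
  qed
qed

lemma complex_with_operator:
  assumes \<chi>: "\<chi> \<in> chars N"
  shows "complex_with_operator fscale cobd T (cochains M \<chi>) (\<chi> t)"
proof -
  interpret T: Vector_Spaces.linear fscale fscale T by (rule linear_T)
  show ?thesis
  proof unfold_locales
    show "\<exists>v\<in>cochains M \<chi>. T v - fscale (\<chi> t) v = w" if "w \<in> cochains M \<chi>" for w
      unfolding T_def using that by (rule translation_surj[OF \<chi> _ char_nonzero[OF \<chi> t]])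
  qed (use subspace_cochains cobd_cochains T_cochains[OF \<chi>] in \<open>auto simp: cobd_cobd T_cobd\<close>)
qed

lemma quotient_finite_span:
  assumes \<chi>: "\<chi> \<in> chars N" and S: "finite S" "cocycles M \<chi> \<subseteq> fs.span (S \<union> coboundaries M \<chi>)"
  shows "\<exists>S'. finite S' \<and> cocycles N \<chi> \<subseteq> fs.span (S' \<union> coboundaries N \<chi>)"
proof -
  interpret C: complex_with_operator fscale cobd T "cochains M \<chi>" "\<chi> t"
    by (rule complex_with_operator[OF \<chi>])
  show ?thesis
    using C.eigenspace_finite_span S
    unfolding C.Z_def C.E_def C.ZE_def eigenspace[OF \<chi>] cocycles_def coboundaries_def by blast
qed

lemma quotient_acyclic:
  assumes \<chi>: "\<chi> \<in> chars N"
    and "\<forall>z\<in>cocycles M \<chi>. T z - fscale (\<chi> t) z \<in> coboundaries M \<chi> \<longrightarrow> z \<in> coboundaries M \<chi>"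
    and "\<forall>z\<in>cocycles M \<chi>. \<exists>y\<in>cocycles M \<chi>. z - (T y - fscale (\<chi> t) y) \<in> coboundaries M \<chi>"
  shows "acyclic_cochains N \<chi>"
proof -
  interpret C: complex_with_operator fscale cobd T "cochains M \<chi>" "\<chi> t"
    by (rule complex_with_operator[OF \<chi>])
  show ?thesis
    using C.eigenspace_exact assms
    unfolding C.Z_def C.E_def C.ZE_def eigenspace[OF \<chi>] cocycles_def coboundaries_def
      acyclic_cochains_def by blast
qed

text \<open>The complex of \<open>M\<close>-cochains and the operator \<open>T\<close> on it see
  \<open>\<chi>\<close> only through its restriction \<open>\<phi>\<close>, so one finite set serves
  all extensions of \<open>\<phi>\<close> to \<open>N\<close>.\<close>

lemma exceptional_values:
  assumes fin: "finite_cohomology M"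
  shows "\<exists>\<Lambda>. finite \<Lambda> \<and>
    (\<forall>\<chi>\<in>chars N. restrict \<chi> M = \<phi> \<longrightarrow> \<not> acyclic_cochains N \<chi> \<longrightarrow> \<chi> t \<in> \<Lambda>)"
proof (cases "\<exists>\<chi>\<in>chars N. restrict \<chi> M = \<phi>")
  case False
  then show ?thesis by blast
next
  case True
  \<comment> \<open>One extension \<open>\<psi>\<close> to \<open>N\<close> is enough to see that
    \<open>T\<close> preserves the \<open>M\<close>-cochains for \<open>\<phi>\<close>.\<close>
  then obtain \<psi> where \<psi>: "\<psi> \<in> chars N" "restrict \<psi> M = \<phi>" by blast
  let ?Z = "cocycles M \<phi>" and ?B = "coboundaries M \<phi>"
  have \<phi>: "cocycles M \<psi> = ?Z" "coboundaries M \<psi> = ?B" "cochains M \<psi> = cochains M \<phi>"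
    using \<psi>(2) restrict_cocycles restrict_coboundaries restrict_cochains by metis+
  have "\<phi> \<in> chars M" using \<psi> MN M restrict_char by blast
  then obtain S where S: "finite S" "?Z \<subseteq> fs.span (S \<union> ?B)"
    using fin by (auto simp: finite_cohomology_def)
  have TK: "T f \<in> cochains M \<phi>" if "f \<in> cochains M \<phi>" for f
    using T_cochains[OF \<psi>(1)] that \<phi> by simp
  interpret T: vector_space_operator fscale T
    by (rule vector_space_operator.intro[OF fs.vector_space_axioms linear_T])
  have "T ` ?Z \<subseteq> ?Z"
    using TK by (auto simp: cocycles_def T.T.zero simp flip: T_cobd)
  moreover have "T ` ?B \<subseteq> ?B"
    using TK by (auto simp: coboundaries_def T_cobd)
  ultimately obtain \<Lambda> where \<Lambda>: "finite \<Lambda>" "\<And>c. c \<notin> \<Lambda> \<Longrightarrow>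
      (\<forall>z\<in>?Z. T z - fscale c z \<in> ?B \<longrightarrow> z \<in> ?B) \<and> (\<forall>z\<in>?Z. \<exists>y\<in>?Z. z - (T y - fscale c y) \<in> ?B)"
    using T.bijective_mod_except_finite[OF subspace_cocycles _ subspace_coboundaries _
        coboundaries_subset S] by blast
  have "\<chi> t \<in> \<Lambda>" if \<chi>: "\<chi> \<in> chars N" "restrict \<chi> M = \<phi>" "\<not> acyclic_cochains N \<chi>" for \<chi>
  proof (rule ccontr)
    assume "\<chi> t \<notin> \<Lambda>"
    moreover have "cocycles M \<chi> = ?Z" "coboundaries M \<chi> = ?B"
      using \<chi>(2) restrict_cocycles restrict_coboundaries by metis+
    ultimately show False using quotient_acyclic[OF \<chi>(1)] \<Lambda>(2) \<chi>(3) by simp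
  qed
  then show ?thesis using \<Lambda>(1) by blast
qed

text \<open>An exceptional character of \<open>N\<close> restricts to one of the finitely many in
  \<open>X\<close>, which leaves finitely many values at \<open>t\<close>; and \<open>M\<close> and
  \<open>t\<close> generate \<open>N\<close>.\<close>

lemma finite_cohomology_quotient:
  assumes fin: "finite_cohomology M"
  shows "finite_cohomology N"
proof -
  define X where "X = {\<phi> \<in> chars M. \<not> acyclic_cochains M \<phi>}"
  obtain F where F: "\<And>\<phi>. finite (F \<phi>)" "\<And>\<phi> \<chi>. \<chi> \<in> chars N \<Longrightarrow> restrict \<chi> M = \<phi> \<Longrightarrow>
      \<not> acyclic_cochains N \<chi> \<Longrightarrow> \<chi> t \<in> F \<phi>"
    using exceptional_values[OF fin] by metis
  have "restrict \<chi> M \<in> X" if \<chi>: "\<chi> \<in> chars N" "\<not> acyclic_cochains N \<chi>" for \<chi>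
  proof -
    have "\<not> cocycles M \<chi> \<subseteq> coboundaries M \<chi>"
    proof
      assume sub: "cocycles M \<chi> \<subseteq> coboundaries M \<chi>"
      interpret T: Vector_Spaces.linear fscale fscale T by (rule linear_T)
      \<comment> \<open>If \<open>M\<close> is acyclic for \<open>\<chi>\<close>, both conditions of
        \<open>quotient_acyclic\<close> hold, the second with \<open>y = 0\<close>.\<close>
      have "0 \<in> cocycles M \<chi>" by (rule fs.subspace_0[OF subspace_cocycles])
      moreover have "z - (T 0 - fscale (\<chi> t) 0) = z" for z by (simp add: T.zero)
      ultimately have "acyclic_cochains N \<chi>"
        using sub by (intro quotient_acyclic[OF \<chi>(1)]) (metis subsetD)+
      then show False using \<chi>(2) by simp
    qed
    then show ?thesis
      using \<chi>(1) restrict_char[OF MN M] restrict_acyclic by (auto simp: X_def acyclic_cochains_def)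
  qed
  then have "{\<chi> \<in> chars N. \<not> acyclic_cochains N \<chi>}
      \<subseteq> {\<chi> \<in> chars N. restrict \<chi> M \<in> X \<and> (\<forall>s\<in>{t}. \<chi> s \<in> F (restrict \<chi> M))}"
    using F(2) by blast
  moreover have "finite \<dots>"
    using fin F(1) by (intro finite_chars[OF N generate_N]) (auto simp: X_def finite_cohomology_def)
  ultimately have "finite {\<chi> \<in> chars N. \<not> acyclic_cochains N \<chi>}" by (rule finite_subset)
  moreover have "\<exists>S. finite S \<and> cocycles N \<chi> \<subseteq> fs.span (S \<union> coboundaries N \<chi>)"
    if \<chi>: "\<chi> \<in> chars N" for \<chi>
  proof -
    have "restrict \<chi> M \<in> chars M" by (rule restrict_char[OF MN M \<chi>])
    then obtain S where "finite S" "cocycles M \<chi> \<subseteq> fs.span (S \<union> coboundaries M \<chi>)"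
      using fin by (auto simp: finite_cohomology_def restrict_cocycles restrict_coboundaries)
    then show ?thesis by (rule quotient_finite_span[OF \<chi>])
  qed
  ultimately show ?thesis by (simp add: finite_cohomology_def)
qed

end

section \<open>Subgroups of finite index\<close>

context group
begin

context
  fixes M N
  assumes M: "subgroup M G" and N: "subgroup N G" and MN: "M \<subseteq> N"
    and index: "finite ((\<lambda>h. M #> h) ` N)"
begin

text \<open>By the pigeonhole principle two powers of \<open>s\<close> share a coset of
  \<open>M\<close>; their quotient lies in \<open>M\<close>.\<close>

lemma power_in_finite_index:
  assumes s: "s \<in> N"
  shows "\<exists>k>0::nat. s [^] k \<in> M"
proof -
  have sG: "s \<in> carrier G" using N s by (rule subgroup.mem_carrier)
  have pow: "s [^] k \<in> N" for k :: nat
    using subgroup_int_pow_closed[OF N s, of "int k"] by (simp add: int_pow_int)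
  have "range (\<lambda>k::nat. M #> s [^] k) \<subseteq> (\<lambda>h. M #> h) ` N" using pow by blast
  then have "\<not> inj (\<lambda>k::nat. M #> s [^] k)"
    using finite_subset[OF _ index] finite_imageD infinite_UNIV_nat by metis
  then obtain i j :: nat where "i \<noteq> j" "M #> s [^] i = M #> s [^] j" by (auto simp: inj_def)
  then obtain i j :: nat where ij: "i < j" "M #> s [^] i = M #> s [^] j"
    by (metis linorder_neqE_nat)
  have "s [^] j \<in> M #> s [^] i" using rcos_self[OF _ M, of "s [^] j"] ij(2) sG by simp
  then obtain m where m: "m \<in> M" "s [^] j = m \<otimes> s [^] i" by (auto simp: r_coset_def)
  have mG: "m \<in> carrier G" using M m(1) by (rule subgroup.mem_carrier)
  have "s [^] (j - i) \<otimes> s [^] i = m \<otimes> s [^] i"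
    using ij(1) m(2) sG by (simp add: nat_pow_mult)
  then have "s [^] (j - i) = m" using sG mG by simp
  then show ?thesis using ij(1) m(1) by (intro exI[of _ "j - i"]) simp
qed

text \<open>Averaging over the cosets is a chain map that is the identity on equivariant cochains.\<close>

lemma transfer:
  assumes \<chi>: "\<chi> \<in> chars N" and f: "f \<in> cochains N \<chi>" "f \<in> coboundaries M \<chi>"
  shows "f \<in> coboundaries N \<chi>"
proof -
  obtain u where u: "u \<in> cochains M \<chi>" "f = cobd u" using f(2) by (auto simp: coboundaries_def)
  define R where "R = (\<lambda>h. M #> h) ` N"
  define g where "g C = (SOME h. h \<in> C)" for C :: "'a set"
  \<comment> \<open>The translate of \<open>u\<close> by a representative of the coset, with the
    character divided out. Equivariance of \<open>u\<close> under \<open>M\<close> makes it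
    independent of the representative.\<close>
  define q where "q u C x = inverse (\<chi> (g C)) * u (map (act (g C)) x)"
    for u :: "'a list \<Rightarrow> complex" and C x
  define A where "A u x = (\<Sum>C\<in>R. q u C x) / card R" for u :: "'a list \<Rightarrow> complex" and x
  have R: "finite R" "R \<noteq> {}" using index subgroup.one_closed[OF N] by (auto simp: R_def)
  have NG: "h \<in> carrier G" if "h \<in> N" for h using N that by (rule subgroup.mem_carrier)
  have g: "\<exists>m\<in>M. g (M #> h) = m \<otimes> h" if "h \<in> N" for h
  proof -
    have "g (M #> h) \<in> M #> h"
      unfolding g_def using rcos_self[OF NG[OF that] M] by (rule someI)
    then show ?thesis by (auto simp: r_coset_def)
  qed
  have gN: "g C \<in> N" if C: "C \<in> R" for C
  proof -
    obtain h where h: "h \<in> N" "C = M #> h" using C unfolding R_def by blast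
    obtain m where "m \<in> M" "g C = m \<otimes> h" using g[OF h(1)] h(2) by blast
    then show ?thesis using h(1) MN subgroup.m_closed[OF N] by auto
  qed
  have q: "q u (M #> h) x = inverse (\<chi> h) * u (map (act h) x)" if h: "h \<in> N" for h x
  proof -
    obtain m where m: "m \<in> M" "g (M #> h) = m \<otimes> h" using g[OF h] by blast
    have mN: "m \<in> N" using m MN by blast
    have "u (map (act (m \<otimes> h)) x) = u (map (act m) (map (act h) x))"
      using NG[OF h] NG[OF mN] by simp
    also have "\<dots> = \<chi> m * u (map (act h) x)" using u(1) m(1) unfolding cochains_def by blast
    finally show ?thesis
      using char_nonzero[OF \<chi> mN] by (simp add: q_def m(2) char_mult[OF \<chi> mN h])
  qed
  have "A u (map (act n) x) = \<chi> n * A u x" if n: "n \<in> N" for n x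
  proof -
    \<comment> \<open>Right multiplication by \<open>n\<close> permutes the cosets and brings out
      the factor \<open>\<chi> n\<close>.\<close>
    have trans: "q u C (map (act n) x) = \<chi> n * q u (C #> n) x \<and> C #> n \<in> R" if C: "C \<in> R" for C
    proof -
      obtain h where h: "h \<in> N" "C = M #> h" using C unfolding R_def by blast
      have hn: "h \<otimes> n \<in> N" using h(1) n N by (simp add: subgroup.m_closed)
      have Cn: "C #> n = M #> (h \<otimes> n)"
        using NG h n M by (simp add: coset_mult_assoc subgroup.subset)
      have "q u C (map (act n) x) = inverse (\<chi> h) * u (map (act (h \<otimes> n)) x)"
        unfolding h(2) q[OF h(1)] using NG h(1) n by simp
      also have "\<dots> = \<chi> n * q u (C #> n) x"
        unfolding Cn q[OF hn] using char_nonzero[OF \<chi> n] by (simp add: char_mult[OF \<chi> h(1) n])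
      finally show ?thesis using Cn hn by (auto simp: R_def)
    qed
    have RG: "C \<subseteq> carrier G" if "C \<in> R" for C
      using that NG subgroup.subset[OF M] by (auto simp: R_def r_coset_def)
    have inj: "inj_on (\<lambda>C. C #> n) R"
    proof (rule inj_on_inverseI)
      fix C assume "C \<in> R"
      then show "C #> n #> inv n = C" using RG NG[OF n] by (simp add: coset_mult_assoc)
    qed
    have image: "(\<lambda>C. C #> n) ` R = R"
      using trans inj R(1) by (intro endo_inj_surj) auto
    have "(\<Sum>C\<in>R. q u C (map (act n) x)) = (\<Sum>C\<in>R. \<chi> n * q u (C #> n) x)"
      using trans by (intro sum.cong) auto
    also have "\<dots> = \<chi> n * (\<Sum>C\<in>R. q u (C #> n) x)" by (simp add: sum_distrib_left)
    also have "(\<Sum>C\<in>R. q u (C #> n) x) = (\<Sum>C\<in>R. q u C x)"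
      using sum.reindex[OF inj, of "\<lambda>C. q u C x"] image by simp
    finally show ?thesis by (simp add: A_def)
  qed
  moreover have "A u [] = 0" using u(1) by (simp add: A_def q_def cochains_def)
  ultimately have Au: "A u \<in> cochains N \<chi>" by (simp add: cochains_def)
  have "A u = (\<Sum>C\<in>R. fscale (inverse (\<chi> (g C)) / card R) (\<lambda>x. u (map (act (g C)) x)))"
    by (auto simp: A_def q_def fscale_def sum_divide_distrib fun_eq_iff sum_fun_apply)
  then have "cobd (A u) x = (\<Sum>C\<in>R. inverse (\<chi> (g C)) / card R * f (map (act (g C)) x))" for x
    by (simp only: cobd.sum sum_fun_apply fscale_def cobd_scale u(2) cobd_map)
  \<comment> \<open>As \<open>f\<close> is equivariant under \<open>N\<close>, all summands agree
    and averaging returns \<open>f\<close>.\<close>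
  moreover have "inverse (\<chi> (g C)) / card R * f (map (act (g C)) x) = f x / card R" if "C \<in> R" for C x
    using f(1) gN[OF that] char_nonzero[OF \<chi> gN[OF that]] by (simp add: cochains_def)
  ultimately have "f = cobd (A u)" using R by (simp add: fun_eq_iff)
  then show ?thesis using Au unfolding coboundaries_def by blast
qed

text \<open>By \<open>transfer\<close> the cohomology of \<open>N\<close> embeds into that of
  \<open>M\<close>, so finite dimension and vanishing pass to \<open>N\<close>. Each
  \<open>s \<in> S\<close> has a power in \<open>M\<close>, hence the restriction to
  \<open>M\<close> determines \<open>\<chi> s\<close> up to a root of unity.\<close>

lemma finite_cohomology_finite_index:
  assumes gen: "N = generate G (M \<union> S)" "finite S" and fin: "finite_cohomology M"
  shows "finite_cohomology N"
proof -
  define X where "X = {\<phi> \<in> chars M. \<not> acyclic_cochains M \<phi>}"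
  have sub: "M \<union> S \<subseteq> N" using gen(1) by (auto intro: generate.incl)
  have ZN: "cocycles N \<chi> \<subseteq> cocycles M \<chi>" for \<chi>
    using cochains_mono[OF MN] by (auto simp: cocycles_def)
  have BN: "cocycles N \<chi> \<inter> coboundaries M \<chi> \<subseteq> coboundaries N \<chi>" if "\<chi> \<in> chars N" for \<chi>
    using transfer[OF that] by (auto simp: cocycles_def)
  obtain k where k: "\<And>s. s \<in> S \<Longrightarrow> k s > (0::nat) \<and> s [^] k s \<in> M"
    using power_in_finite_index sub by (metis UnCI subsetD)
  have "restrict \<chi> M \<in> X" if "\<chi> \<in> chars N" "\<not> acyclic_cochains N \<chi>" for \<chi>
    using that ZN[of \<chi>] BN[of \<chi>] restrict_char[OF MN M, of \<chi>] restrict_acyclic[of M \<chi>]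
    unfolding X_def acyclic_cochains_def by blast
  moreover have "\<chi> s ^ k s = restrict \<chi> M (s [^] k s)" if "\<chi> \<in> chars N" "s \<in> S" for \<chi> s
    using that sub k by (simp add: char_pow[OF N] subset_iff)
  ultimately have "{\<chi> \<in> chars N. \<not> acyclic_cochains N \<chi>} \<subseteq> {\<chi> \<in> chars N. restrict \<chi> M \<in> X \<and>
      (\<forall>s\<in>S. \<chi> s \<in> {z. z ^ k s = restrict \<chi> M (s [^] k s)})}"
    by blast
  moreover have "finite \<dots>"
  proof (rule finite_chars[OF N gen(1) _ gen(2)])
    show "M \<union> S \<subseteq> carrier G" using sub subgroup.subset[OF N] by blast
    show "finite X" using fin by (simp add: X_def finite_cohomology_def)
  qed (use k in auto)
  ultimately have "finite {\<chi> \<in> chars N. \<not> acyclic_cochains N \<chi>}" by (rule finite_subset)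
  moreover have "\<exists>S. finite S \<and> cocycles N \<chi> \<subseteq> fs.span (S \<union> coboundaries N \<chi>)"
    if \<chi>: "\<chi> \<in> chars N" for \<chi>
  proof -
    have "restrict \<chi> M \<in> chars M" by (rule restrict_char[OF MN M \<chi>])
    then obtain S where S: "finite S" "cocycles M \<chi> \<subseteq> fs.span (S \<union> coboundaries M \<chi>)"
      using fin by (auto simp: finite_cohomology_def restrict_cocycles restrict_coboundaries)
    \<comment> \<open>Applied to the identity, \<open>finite_span_vimage\<close> gives generators
      that are cocycles of \<open>N\<close>.\<close>
    then have "(\<lambda>v. v) ` cocycles N \<chi> \<subseteq> fs.span (S \<union> coboundaries M \<chi>)" using ZN by auto
    from linear.finite_span_vimage[OF fs.linear_ident S(1) subspace_cocycles this]
    obtain S' where S': "finite S'" "cocycles N \<chi> \<subseteq>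
        fs.span (S' \<union> {v \<in> cocycles N \<chi>. v \<in> fs.span (coboundaries M \<chi>)})"
      by blast
    have "{v \<in> cocycles N \<chi>. v \<in> fs.span (coboundaries M \<chi>)} \<subseteq> coboundaries N \<chi>"
      using BN[OF \<chi>] unfolding fs.span_eq_iff[THEN iffD2, OF subspace_coboundaries] by blast
    then have "cocycles N \<chi> \<subseteq> fs.span (S' \<union> coboundaries N \<chi>)"
      using S'(2) fs.span_mono by (meson Un_mono order_refl order_trans)
    then show ?thesis using S'(1) by blast
  qed
  ultimately show ?thesis by (simp add: finite_cohomology_def)
qed

end

section \<open>Virtually polycyclic groups\<close>

text \<open>Let \<open>t\<close> lift a generator of the quotient. Either no nonzero power of
  \<open>t\<close> lies in \<open>M\<close>, which is the infinite cyclic case, or \<open>M\<close>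
  has finite index in \<open>N\<close>.\<close>

lemma finite_cohomology_cyclic_quotient:
  assumes M: "subgroup M G" and N: "subgroup N G" and normal: "normal M (G\<lparr>carrier := N\<rparr>)"
    and cyclic: "cyclic_group (G\<lparr>carrier := N\<rparr> Mod M)" and fin: "finite_cohomology M"
  shows "finite_cohomology N"
proof -
  interpret N: normal M "G\<lparr>carrier := N\<rparr>" by (rule normal)
  interpret Q: group "G\<lparr>carrier := N\<rparr> Mod M" by (rule N.factorgroup_is_group)
  have MN: "M \<subseteq> N" using N.subset by simp
  have NG: "h \<in> carrier G" if "h \<in> N" for h using N that by (rule subgroup.mem_carrier)
  have MG: "m \<in> carrier G" if "m \<in> M" for m using MN NG that by blast
  have conj: "h \<otimes> m \<otimes> inv h \<in> M" if "h \<in> N" "m \<in> M" for h m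
    using N.inv_op_closed2[of h m] that m_inv_consistent[OF N that(1)] by simp
  obtain C where C: "C \<in> carrier (G\<lparr>carrier := N\<rparr> Mod M)"
      "carrier (G\<lparr>carrier := N\<rparr> Mod M) = range (\<lambda>n::int. C [^]\<^bsub>G\<lparr>carrier := N\<rparr> Mod M\<^esub> n)"
    using cyclic Q.cyclic_group by blast
  obtain t where t: "t \<in> N" "C = M #> t"
    using C(1) by (auto simp: FactGroup_def RCOSETS_def r_coset_def)
  have hom: "(\<lambda>h. M #> h) \<in> hom (G\<lparr>carrier := N\<rparr>) (G\<lparr>carrier := N\<rparr> Mod M)"
    using N.r_coset_hom_Mod by (simp add: r_coset_def)
  have pow: "C [^]\<^bsub>G\<lparr>carrier := N\<rparr> Mod M\<^esub> n = M #> t [^] n" for n :: int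
  proof -
    interpret H: group_hom "G\<lparr>carrier := N\<rparr>" "G\<lparr>carrier := N\<rparr> Mod M" "\<lambda>h. M #> h"
      using hom by unfold_locales
    show ?thesis
      using H.hom_int_pow[of t n] t int_pow_consistent[OF N t(1), of n] by simp
  qed
  have cyc: "\<exists>m\<in>M. \<exists>k::int. h = m \<otimes> t [^] k" if h: "h \<in> N" for h
  proof -
    have "M #> h \<in> carrier (G\<lparr>carrier := N\<rparr> Mod M)"
      using h by (auto simp: FactGroup_def RCOSETS_def r_coset_def)
    then obtain k :: int where "M #> h = M #> t [^] k" using C(2) pow by auto
    then have "h \<in> M #> t [^] k" using rcos_self[OF NG[OF h] M] by simp
    then show ?thesis by (auto simp: r_coset_def)
  qed
  show ?thesis
  proof (cases "\<forall>k::int. t [^] k \<in> M \<longrightarrow> k = 0")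
    case True
    then interpret infinite_cyclic_quotient G M N t
      by (intro infinite_cyclic_quotient.intro infinite_cyclic_quotient_axioms.intro group_axioms
          M N MN conj t(1) cyc) auto
    show ?thesis by (rule finite_cohomology_quotient[OF fin])
  next
    case False
    then obtain l :: int where l: "t [^] l \<in> M" "l \<noteq> 0" by blast
    define p where "p = \<bar>l\<bar>"
    have p: "p > 0" "t [^] p \<in> M"
      using l M NG[OF t(1)] subgroup.m_inv_closed[OF M l(1)]
      by (auto simp: p_def abs_if int_pow_neg)
    \<comment> \<open>By division with remainder, exponents from \<open>0\<close> to
      \<open>p - 1\<close> represent all cosets.\<close>
    have "M #> h \<in> (\<lambda>k. M #> t [^] k) ` {0..<p}" if h: "h \<in> N" for h
    proof -
      obtain m and k :: int where mk: "m \<in> M" "h = m \<otimes> t [^] k" using cyc[OF h] by blast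
      have "t [^] k = t [^] (p * (k div p)) \<otimes> t [^] (k mod p)"
        using NG[OF t(1)] by (simp flip: int_pow_mult)
      also have "t [^] (p * (k div p)) = (t [^] p) [^] (k div p)"
        using NG[OF t(1)] by (simp add: int_pow_pow)
      finally have "h = (m \<otimes> (t [^] p) [^] (k div p)) \<otimes> t [^] (k mod p)"
        using mk MG NG[OF t(1)] by (simp add: m_assoc)
      moreover have "m \<otimes> (t [^] p) [^] (k div p) \<in> M"
        using mk(1) p(2) M by (simp add: subgroup.m_closed subgroup_int_pow_closed)
      ultimately have "h \<in> M #> t [^] (k mod p)" by (auto simp: r_coset_def)
      then have "M #> h = M #> t [^] (k mod p)"
        using NG[OF t(1)] M by (intro repr_independence[symmetric]) auto
      then show ?thesis using p(1) by auto
    qed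
    then have index: "finite ((\<lambda>h. M #> h) ` N)"
      by (rule finite_subset[OF image_subsetI]) (assumption, simp)
    have "N = generate G (M \<union> {t})" by (rule generate_cyclic_quotient[OF N MN t(1) cyc])
    then show ?thesis by (rule finite_cohomology_finite_index[OF M N MN index _ _ fin]) simp
  qed
qed

text \<open>The series is climbed from its trivial last term up to \<open>H\<close>; the induction
  variable counts terms from the end.\<close>

lemma finite_cohomology_polycyclic:
  assumes H: "subgroup H G" and poly: "polycyclic (G\<lparr>carrier := H\<rparr>)"
  shows "finite_cohomology H"
proof -
  obtain Hs where Hs: "Hs \<noteq> []" "hd Hs = H" "last Hs = {\<one>}"
    and step: "\<And>j. Suc j < length Hs \<Longrightarrow> subgroup (Hs ! Suc j) (G\<lparr>carrier := H\<rparr>) \<and>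
        normal (Hs ! Suc j) (G\<lparr>carrier := Hs ! j\<rparr>) \<and>
        cyclic_group ((G\<lparr>carrier := Hs ! j\<rparr>) Mod (Hs ! Suc j))"
    using poly unfolding polycyclic_def by auto
  have sub: "subgroup (Hs ! j) G" if "j < length Hs" for j
  proof (cases j)
    case 0
    then show ?thesis using Hs H by (simp add: hd_conv_nth)
  next
    case (Suc i)
    then show ?thesis using step[of i] that incl_subgroup[OF H] by simp
  qed
  have "finite_cohomology (Hs ! (length Hs - Suc i))" if "i < length Hs" for i
    using that
  proof (induction i)
    case 0
    then show ?case using Hs finite_cohomology_trivial by (simp add: last_conv_nth)
  next
    case (Suc i)
    define j where "j = length Hs - Suc (Suc i)"
    have j: "Suc j < length Hs" "length Hs - Suc i = Suc j" using Suc.prems by (auto simp: j_def)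
    then show ?case
      using Suc step[OF j(1)] sub[of j] sub[of "Suc j"] finite_cohomology_cyclic_quotient
      by (simp flip: j_def)
  qed
  from this[of "length Hs - 1"] show ?thesis using Hs by (simp add: hd_conv_nth)
qed

lemma finite_cohomology_virtually_polycyclic:
  assumes fg: "finitely_generated_group G" and vp: "virtually_polycyclic G"
  shows "finite_cohomology (carrier G)"
proof -
  obtain H where H: "subgroup H G" "finite (rcosets H)" "polycyclic (G\<lparr>carrier := H\<rparr>)"
    using vp by (auto simp: virtually_polycyclic_def)
  obtain S where S: "finite S" "S \<subseteq> carrier G" "generate G S = carrier G"
    using fg by (auto simp: finitely_generated_group_def)
  have "carrier G = generate G (H \<union> S)"
    using mono_generate[of S "H \<union> S"] generate_incl[of "H \<union> S"] S subgroup.subset[OF H(1)] by blast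
  moreover have "(\<lambda>h. H #> h) ` carrier G = rcosets H" by (auto simp: RCOSETS_def)
  ultimately show ?thesis
    using finite_cohomology_finite_index[OF H(1) subgroup_self subgroup.subset[OF H(1)]] H(2) S(1)
      finite_cohomology_polycyclic[OF H(1,3)] by simp
qed

end

section \<open>Comparison with the bar complex\<close>

lemma cobd_sum:
  "cobd f x = (\<Sum>i<length x. (- 1) ^ i * f (take i x @ drop (Suc i) x))"
proof (induction x arbitrary: f)
  case (Cons a x)
  show ?case
    using Cons[of "\<lambda>y. f (a # y)"]
    by (simp add: sum.lessThan_Suc_shift sum_negf del: sum.lessThan_Suc)
qed simp

section \<open>The bar complex and its dual\<close>

definition bar_basis :: "'a list \<Rightarrow> 'a list \<Rightarrow> complex" where
  "bar_basis v = (\<lambda>w. if w = v then 1 else 0)"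

lemma bar_basis_chains: "length w = n \<Longrightarrow> set w \<subseteq> carrier G \<Longrightarrow> bar_basis w \<in> bar_chains G n"
  by (auto simp: bar_chains_def bar_basis_def)

text \<open>The transpose of \<open>bar_bd\<close>: on a nonempty word \<open>w\<close> it is the
  functional \<open>U\<close> applied to the boundary of \<open>w\<close>.\<close>

definition bar_cobd ::
  "('a, 'b) monoid_scheme \<Rightarrow> ('a \<Rightarrow> complex) \<Rightarrow> ('a list \<Rightarrow> complex) \<Rightarrow> 'a list \<Rightarrow> complex" where
  "bar_cobd G \<rho> U w = \<rho> (hd w) * U (tl w)
     + (\<Sum>j\<in>{1..<length w}. (- 1) ^ j * U (bar_merge G j w)) + (- 1) ^ length w * U (butlast w)"

lemma bar_bd_eq_sum:
  assumes "finite W" "{w. c w \<noteq> 0} \<subseteq> W"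
  shows "bar_bd G \<rho> n c v = (\<Sum>w\<in>W. c w * bar_bd_coeff G \<rho> n w v)"
  unfolding bar_bd_def using assms by (intro sum.mono_neutral_left) auto

lemma subspace_bar_boundaries: "fs.subspace (bar_boundaries G \<rho> n)"
proof (rule fs.subspaceI)
  have "bar_bd G \<rho> (Suc n) (\<lambda>_. 0) = 0" by (simp add: bar_bd_def zero_fun_def)
  moreover have "(\<lambda>_. 0) \<in> bar_chains G (Suc n)" by (simp add: bar_chains_def)
  ultimately show "0 \<in> bar_boundaries G \<rho> n" unfolding bar_boundaries_def by (metis imageI)
next
  fix x y assume "x \<in> bar_boundaries G \<rho> n" "y \<in> bar_boundaries G \<rho> n"
  then obtain b c where bc: "b \<in> bar_chains G (Suc n)" "c \<in> bar_chains G (Suc n)"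
      "x = bar_bd G \<rho> (Suc n) b" "y = bar_bd G \<rho> (Suc n) c"
    by (auto simp: bar_boundaries_def)
  define W where "W = {w. b w \<noteq> 0} \<union> {w. c w \<noteq> 0}"
  have W: "finite W" "{w. (b + c) w \<noteq> 0} \<subseteq> W" "{w. b w \<noteq> 0} \<subseteq> W" "{w. c w \<noteq> 0} \<subseteq> W"
    using bc(1,2) by (auto simp: W_def bar_chains_def)
  have "b + c \<in> bar_chains G (Suc n)"
  proof -
    have "b w \<noteq> 0 \<or> c w \<noteq> 0" if "(b + c) w \<noteq> 0" for w using that by auto
    then show ?thesis
      using bc(1,2) finite_subset[OF W(2,1)] unfolding bar_chains_def by blast
  qed
  moreover have "x + y = bar_bd G \<rho> (Suc n) (b + c)"
    by (rule ext) (simp add: bc bar_bd_eq_sum[OF W(1,2)] bar_bd_eq_sum[OF W(1,3)]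
        bar_bd_eq_sum[OF W(1,4)] sum.distrib distrib_right)
  ultimately show "x + y \<in> bar_boundaries G \<rho> n" by (auto simp: bar_boundaries_def)
next
  fix a x assume "x \<in> bar_boundaries G \<rho> n"
  then obtain c where c: "c \<in> bar_chains G (Suc n)" "x = bar_bd G \<rho> (Suc n) c"
    by (auto simp: bar_boundaries_def)
  have W: "finite {w. c w \<noteq> 0}" "{w. fscale a c w \<noteq> 0} \<subseteq> {w. c w \<noteq> 0}"
    using c(1) by (auto simp: bar_chains_def fscale_def)
  have "fscale a c \<in> bar_chains G (Suc n)"
    using c(1) finite_subset[OF W(2,1)] by (auto simp: bar_chains_def fscale_def)
  moreover have "fscale a x = bar_bd G \<rho> (Suc n) (fscale a c)"
  proof
    show "fscale a x v = bar_bd G \<rho> (Suc n) (fscale a c) v" for v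
      unfolding c(2) bar_bd_eq_sum[OF W]
      by (simp add: bar_bd_def fscale_def sum_distrib_left mult.assoc)
  qed
  ultimately show "fscale a x \<in> bar_boundaries G \<rho> n" by (auto simp: bar_boundaries_def)
qed

lemma bar_bd_basis:
  assumes "length w = Suc n"
  shows "bar_bd G \<rho> (Suc n) (bar_basis w) = fscale (\<rho> (hd w)) (bar_basis (tl w))
    + (\<Sum>j\<in>{1..<length w}. fscale ((- 1) ^ j) (bar_basis (bar_merge G j w)))
    + fscale ((- 1) ^ length w) (bar_basis (butlast w))"
proof
  fix v
  have "{x. bar_basis w x \<noteq> 0} = {w}" by (auto simp: bar_basis_def)
  then have "bar_bd G \<rho> (Suc n) (bar_basis w) v = bar_bd_coeff G \<rho> (Suc n) w v"
    by (simp add: bar_bd_def bar_basis_def)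
  then show "bar_bd G \<rho> (Suc n) (bar_basis w) v = (fscale (\<rho> (hd w)) (bar_basis (tl w))
    + (\<Sum>j\<in>{1..<length w}. fscale ((- 1) ^ j) (bar_basis (bar_merge G j w)))
    + fscale ((- 1) ^ length w) (bar_basis (butlast w))) v"
    using assms by (simp add: bar_bd_coeff_def fscale_def bar_basis_def sum_fun_apply eq_commute[of v])
qed

text \<open>Adjointness moves the differential from \<open>U\<close> to \<open>c\<close>, whose
  boundary is zero. Degree zero is excluded because \<open>bar_bd\<close> vanishes there, whereas
  \<open>bar_cobd\<close> at the empty word need not.\<close>

lemma pairing_bar_cycle:
  assumes c: "c \<in> bar_cycles G \<rho> n" and n: "n > 0"
  shows "(\<Sum>w | c w \<noteq> 0. c w * bar_cobd G \<rho> U w) = 0"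
proof -
  let ?W = "{w. c w \<noteq> 0}"
  have fin: "finite ?W" and len: "\<And>w. w \<in> ?W \<Longrightarrow> length w = n"
    using c by (auto simp: bar_cycles_def bar_chains_def)
  define faces where "faces w = {tl w, butlast w} \<union> (\<lambda>j. bar_merge G j w) ` {1..<n}" for w
  \<comment> \<open>A finite set containing all faces of words in \<open>c\<close>, so that the two
    sums can be interchanged.\<close>
  define V where "V = (\<Union>w\<in>?W. faces w)"
  have V: "finite V" using fin by (simp add: V_def faces_def)
  have coeff: "(\<Sum>v\<in>V. bar_bd_coeff G \<rho> n w v * U v) = bar_cobd G \<rho> U w" if w: "w \<in> ?W" for w
  proof -
    have mem: "tl w \<in> V" "butlast w \<in> V" "\<And>j. j \<in> {1..<n} \<Longrightarrow> bar_merge G j w \<in> V"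
      using w by (auto simp: V_def faces_def)
    have delta: "(\<Sum>v\<in>V. a * (if y = v then 1 else 0) * U v) = a * U y" if "y \<in> V" for a y
    proof -
      have "(\<Sum>v\<in>V. a * (if y = v then 1 else 0) * U v) = (\<Sum>v\<in>V. if y = v then a * U v else 0)"
        by (intro sum.cong) auto
      then show ?thesis using V that by simp
    qed
    have "bar_bd_coeff G \<rho> n w v = \<rho> (hd w) * (if tl w = v then 1 else 0)
       + (\<Sum>j\<in>{1..<n}. (- 1) ^ j * (if bar_merge G j w = v then 1 else 0))
       + (- 1) ^ n * (if butlast w = v then 1 else 0)" for v
      using n by (simp add: bar_bd_coeff_def)
    then have "(\<Sum>v\<in>V. bar_bd_coeff G \<rho> n w v * U v)
      = (\<Sum>v\<in>V. \<rho> (hd w) * (if tl w = v then 1 else 0) * U v)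
       + (\<Sum>v\<in>V. \<Sum>j\<in>{1..<n}. (- 1) ^ j * (if bar_merge G j w = v then 1 else 0) * U v)
       + (\<Sum>v\<in>V. (- 1) ^ n * (if butlast w = v then 1 else 0) * U v)"
      by (simp only: distrib_right sum.distrib sum_distrib_right)
    also have "(\<Sum>v\<in>V. \<Sum>j\<in>{1..<n}. (- 1) ^ j * (if bar_merge G j w = v then 1 else 0) * U v)
      = (\<Sum>j\<in>{1..<n}. \<Sum>v\<in>V. (- 1) ^ j * (if bar_merge G j w = v then 1 else 0) * U v)"
      by (rule sum.swap)
    also have "\<dots> = (\<Sum>j\<in>{1..<n}. (- 1) ^ j * U (bar_merge G j w))"
      by (intro sum.cong refl delta mem(3))
    finally show ?thesis
      unfolding delta[OF mem(1)] delta[OF mem(2)] bar_cobd_def len[OF w] .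
  qed
  have "(\<Sum>w\<in>?W. c w * bar_cobd G \<rho> U w) = (\<Sum>w\<in>?W. \<Sum>v\<in>V. c w * bar_bd_coeff G \<rho> n w v * U v)"
    by (intro sum.cong refl) (simp add: coeff[symmetric] sum_distrib_left mult.assoc)
  also have "\<dots> = (\<Sum>v\<in>V. bar_bd G \<rho> n c v * U v)"
    unfolding bar_bd_def sum_distrib_right by (rule sum.swap)
  also have "\<dots> = 0" using c by (simp add: bar_cycles_def)
  finally show ?thesis .
qed

text \<open>A basis of \<open>B\<close> stays independent when \<open>z\<close> is adjoined, so
  values there can be prescribed. This is how a cycle that does not bound is turned into a cocycle
  detecting it.\<close>

lemma (in vector_space) separating_functional:
  assumes B: "subspace B" and z: "z \<notin> B"
  shows "\<exists>\<phi>. Vector_Spaces.linear scale (*) \<phi> \<and> (\<forall>b\<in>B. \<phi> b = 0) \<and> \<phi> z = 1"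
proof -
  interpret field: vector_space "(*) :: 'a \<Rightarrow> 'a \<Rightarrow> 'a"
    by unfold_locales (simp_all add: algebra_simps)
  interpret pair: vector_space_pair scale "(*) :: 'a \<Rightarrow> 'a \<Rightarrow> 'a" ..
  obtain S where S: "S \<subseteq> B" "independent S" "B \<subseteq> span S" by (rule maximal_independent_subset)
  have "span S \<subseteq> B" by (rule span_minimal[OF S(1) B])
  then have zS: "z \<notin> span S" using z by blast
  then have "independent (insert z S)" using S(2) by (rule independent_insertI)
  then obtain \<phi> where \<phi>: "Vector_Spaces.linear scale (*) \<phi>"
      "\<forall>x\<in>insert z S. \<phi> x = (if x = z then 1 else 0)"
    using pair.linear_independent_extend[of "insert z S" "\<lambda>x. if x = z then 1 else 0"] by blast
  interpret \<phi>: Vector_Spaces.linear scale "(*)" \<phi> by (rule \<phi>(1))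
  have "z \<notin> S" using zS span_base by blast
  then have "\<phi> x = 0" if "x \<in> S" for x using \<phi>(2) that by auto
  then have "\<phi> b = 0" if "b \<in> span S" for b using \<phi>.eq_0_on_span that by blast
  then show ?thesis using \<phi> S(3) by (intro exI[of _ \<phi>]) auto
qed

context group
begin

text \<open>The homogeneous simplex of a bar word, started at a given vertex.\<close>

fun walk :: "'a \<Rightarrow> 'a list \<Rightarrow> 'a list" where
  "walk a [] = [a]"
| "walk a (g # w) = a # walk (a \<otimes> g) w"

text \<open>The bar word of a homogeneous simplex. Together with the first vertex it inverts
  \<open>walk\<close>, and its entries are unchanged by left translation.\<close>

fun steps :: "'a list \<Rightarrow> 'a list" where
  "steps (a # b # x) = (inv a \<otimes> b) # steps (b # x)"
| "steps _ = []"

lemma length_walk [simp]: "length (walk a w) = Suc (length w)"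
  by (induction w arbitrary: a) auto

lemma length_steps [simp]: "length (steps x) = length x - 1"
  by (induction x rule: steps.induct) auto

lemma set_steps: "set x \<subseteq> carrier G \<Longrightarrow> set (steps x) \<subseteq> carrier G"
  by (induction x rule: steps.induct) auto

lemma set_walk: "a \<in> carrier G \<Longrightarrow> set w \<subseteq> carrier G \<Longrightarrow> set (walk a w) \<subseteq> carrier G"
  by (induction w arbitrary: a) auto

lemma hd_walk [simp]: "hd (walk a w) = a"
  by (cases w) auto

lemma steps_walk: "a \<in> carrier G \<Longrightarrow> set w \<subseteq> carrier G \<Longrightarrow> steps (walk a w) = w"
proof (induction w arbitrary: a)
  case (Cons g w)
  obtain y where y: "walk (a \<otimes> g) w = (a \<otimes> g) # y" by (cases w) auto
  have "steps (walk a (g # w)) = (inv a \<otimes> (a \<otimes> g)) # steps (walk (a \<otimes> g) w)"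
    by (simp add: y)
  then show ?case using Cons by (simp flip: m_assoc)
qed simp

lemma walk_steps: "x \<noteq> [] \<Longrightarrow> set x \<subseteq> carrier G \<Longrightarrow> walk (hd x) (steps x) = x"
  by (induction x rule: steps.induct) (auto simp flip: m_assoc)

lemma walk_act:
  "h \<in> carrier G \<Longrightarrow> a \<in> carrier G \<Longrightarrow> set w \<subseteq> carrier G \<Longrightarrow> walk (h \<otimes> a) w = map (act h) (walk a w)"
  by (induction w arbitrary: a) (auto simp: act_def m_assoc)

lemma steps_act: "h \<in> carrier G \<Longrightarrow> steps (map (act h) x) = steps (map (act \<one>) x)"
proof (induction x rule: steps.induct)
  case (1 a b x)
  have "inv (act h a) \<otimes> act h b = inv (act \<one> a) \<otimes> act \<one> b"
    using 1(2) by (auto simp: act_def inv_mult_group m_assoc simp flip: m_assoc[of "inv h" h])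
  then show ?case using 1 by simp
qed auto

lemma map_act_one: "set x \<subseteq> carrier G \<Longrightarrow> map (act \<one>) x = x"
  by (auto simp: act_def intro!: map_idI)

text \<open>Without an inner vertex, the two steps meeting there become their product.\<close>

lemma walk_delete_inner:
  assumes "1 \<le> j" "j < length w" "a \<in> carrier G" "set w \<subseteq> carrier G"
  shows "take j (walk a w) @ drop (Suc j) (walk a w) = walk a (bar_merge G j w)"
  using assms
proof (induction w arbitrary: a j)
  case (Cons g w)
  then obtain h w' where w: "w = h # w'" by (cases w) auto
  obtain i where i: "j = Suc i" using Cons.prems(1) by (cases j) auto
  show ?case
  proof (cases i)
    case 0
    then show ?thesis
      using Cons.prems by (cases w') (auto simp: i w bar_merge_def m_assoc)
  next
    case (Suc k)
    have "bar_merge G j (g # w) = g # bar_merge G i w"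
      by (simp add: bar_merge_def i Suc)
    then show ?thesis using Cons.IH[of i "a \<otimes> g"] Cons.prems by (simp add: i Suc)
  qed
qed simp

lemma walk_delete_last:
  "w \<noteq> [] \<Longrightarrow> take (length w) (walk a w) = walk a (butlast w)"
  by (induction w arbitrary: a) auto

lemma set_bar_merge:
  assumes "1 \<le> j" "j < length w" "set w \<subseteq> carrier G"
  shows "set (bar_merge G j w) \<subseteq> carrier G" "length (bar_merge G j w) = length w - 1"
proof -
  have "w ! (j - 1) \<in> carrier G" "w ! j \<in> carrier G" using assms by (auto simp: subset_iff)
  then show "set (bar_merge G j w) \<subseteq> carrier G"
    using assms(3) set_take_subset[of "j - 1" w] set_drop_subset[of "j + 1" w]
    by (auto simp: bar_merge_def)
  show "length (bar_merge G j w) = length w - 1" using assms by (simp add: bar_merge_def)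
qed

text \<open>Without its first vertex the walk is the translate by \<open>hd w\<close> of a walk from
  \<open>\<one>\<close>, whence the factor \<open>\<rho> (hd w)\<close>. Deleting an inner vertex
  merges two letters, and deleting the last vertex drops the last letter.\<close>

lemma cobd_walk:
  assumes \<rho>: "\<rho> \<in> chars (carrier G)" and U: "U \<in> cochains (carrier G) \<rho>"
    and w: "w \<noteq> []" "set w \<subseteq> carrier G"
  shows "cobd U (walk \<one> w) = bar_cobd G \<rho> (\<lambda>v. U (walk \<one> v)) w"
proof -
  let ?t = "\<lambda>i. (- 1) ^ i * U (take i (walk \<one> w) @ drop (Suc i) (walk \<one> w))"
  have split: "{..<length (walk \<one> w)} = insert 0 (insert (length w) {1..<length w})"
    by auto
  have "cobd U (walk \<one> w) = ?t 0 + (?t (length w) + (\<Sum>j\<in>{1..<length w}. ?t j))"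
    unfolding cobd_sum split using w(1) by simp
  also have "?t 0 = \<rho> (hd w) * U (walk \<one> (tl w))"
  proof -
    obtain g w' where g: "w = g # w'" using w(1) by (cases w) auto
    have "U (walk g w') = U (map (act g) (walk \<one> w'))"
      using walk_act[of g \<one> w'] g w(2) by simp
    also have "\<dots> = \<rho> g * U (walk \<one> w')"
      using U g w(2) unfolding cochains_def by auto
    finally show ?thesis using g w(2) by simp
  qed
  also have "?t (length w) = (- 1) ^ length w * U (walk \<one> (butlast w))"
    using w(1) by (simp add: walk_delete_last)
  also have "(\<Sum>j\<in>{1..<length w}. ?t j)
      = (\<Sum>j\<in>{1..<length w}. (- 1) ^ j * U (walk \<one> (bar_merge G j w)))"
    using w(2) by (intro sum.cong refl) (simp add: walk_delete_inner)
  finally show ?thesis by (simp add: bar_cobd_def)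
qed

text \<open>The usual passage from inhomogeneous to homogeneous cochains, extended by zero to the
  other lengths because cochains comprise all degrees.\<close>

definition homogeneous ::
  "('a \<Rightarrow> complex) \<Rightarrow> nat \<Rightarrow> ('a list \<Rightarrow> complex) \<Rightarrow> 'a list \<Rightarrow> complex" where
  "homogeneous \<rho> n f x =
     (if length x = Suc n then \<rho> (act \<one> (hd x)) * f (steps (map (act \<one>) x)) else 0)"

lemma homogeneous_cochains:
  assumes \<rho>: "\<rho> \<in> chars (carrier G)"
  shows "homogeneous \<rho> n f \<in> cochains (carrier G) \<rho>"
proof -
  have "homogeneous \<rho> n f (map (act h) x) = \<rho> h * homogeneous \<rho> n f x" if h: "h \<in> carrier G" for h x
  proof (cases x)
    case (Cons a y)
    have "act \<one> (act h a) = h \<otimes> act \<one> a" using h by (auto simp: act_def)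
    then have "\<rho> (act \<one> (hd (map (act h) x))) = \<rho> h * \<rho> (act \<one> (hd x))"
      by (simp add: Cons char_mult[OF \<rho>] h del: act_act)
    moreover have "steps (map (act \<one>) (map (act h) x)) = steps (map (act \<one>) x)"
      using h steps_act[OF h] by simp
    ultimately show ?thesis by (simp add: homogeneous_def mult.assoc del: map_map)
  qed (simp add: homogeneous_def)
  then show ?thesis by (simp add: cochains_def homogeneous_def)
qed

lemma homogeneous_walk:
  assumes \<rho>: "\<rho> \<in> chars (carrier G)" and v: "length v = n" "set v \<subseteq> carrier G"
  shows "homogeneous \<rho> n f (walk \<one> v) = f v"
  using v char_one[OF subgroup_self \<rho>] set_walk[OF one_closed v(2)]
  by (simp add: homogeneous_def map_act_one steps_walk act_def)

text \<open>On lists of length \<open>n + 2\<close>, equivariance reduces the claim to walks from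
  \<open>\<one>\<close>, where \<open>cobd_walk\<close> applies. In any other length all faces have
  a length at which the cochain is zero.\<close>

lemma homogeneous_cocycle:
  assumes \<rho>: "\<rho> \<in> chars (carrier G)"
    and f: "\<And>w. length w = Suc n \<Longrightarrow> set w \<subseteq> carrier G \<Longrightarrow> bar_cobd G \<rho> f w = 0"
  shows "homogeneous \<rho> n f \<in> cocycles (carrier G) \<rho>"
proof -
  let ?F = "homogeneous \<rho> n f"
  have F: "?F \<in> cochains (carrier G) \<rho>" by (rule homogeneous_cochains[OF \<rho>])
  note dF = cobd_cochains[OF F]
  have "cobd ?F x = 0" for x
  proof (cases "length x = Suc (Suc n)")
    case False
    then show ?thesis
      unfolding cobd_sum by (intro sum.neutral) (auto simp: homogeneous_def)
  next
    case True
    define y where "y = map (act \<one>) x"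
    have y: "y \<noteq> []" "set y \<subseteq> carrier G" "length y = Suc (Suc n)"
      using True by (auto simp: y_def)
    define w where "w = steps y"
    have w: "length w = Suc n" "set w \<subseteq> carrier G" "w \<noteq> []"
      using y set_steps[OF y(2)] by (auto simp: w_def simp flip: length_0_conv)
    have hd: "hd y \<in> carrier G" using y by (cases y) auto
    have "cobd ?F x = cobd ?F y"
      using dF char_one[OF subgroup_self \<rho>] by (simp add: cochains_def y_def)
    also have "y = map (act (hd y)) (walk \<one> w)"
      using walk_steps[OF y(1,2)] walk_act[OF hd one_closed w(2)] hd by (simp add: w_def)
    also have "cobd ?F \<dots> = \<rho> (hd y) * cobd ?F (walk \<one> w)"
      using dF hd unfolding cochains_def by blast
    also have "cobd ?F (walk \<one> w) = bar_cobd G \<rho> (\<lambda>v. ?F (walk \<one> v)) w"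
      by (rule cobd_walk[OF \<rho> F w(3,2)])
    also have "\<dots> = bar_cobd G \<rho> f w"
    proof -
      have "set (tl w) \<subseteq> carrier G" "set (butlast w) \<subseteq> carrier G"
        using w(2,3) by (auto dest: in_set_butlastD list.set_sel(2))
      then show ?thesis
        unfolding bar_cobd_def using w set_bar_merge[OF _ _ w(2)]
        by (simp add: homogeneous_walk[OF \<rho>])
    qed
    also have "\<dots> = 0" by (rule f[OF w(1,2)])
    finally show ?thesis by simp
  qed
  then show ?thesis using F by (auto simp: cocycles_def fun_eq_iff)
qed

text \<open>A cycle that is not a boundary is detected by a functional vanishing on boundaries. Its
  values on words form a cocycle, which is a coboundary by acyclicity and therefore pairs to zero
  with the cycle.\<close>

lemma acyclic_bar:
  assumes \<rho>: "\<rho> \<in> chars (carrier G)" and acyclic: "acyclic_cochains (carrier G) \<rho>"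
  shows "bar_cycles G \<rho> n \<subseteq> bar_boundaries G \<rho> n"
proof
  fix z assume z: "z \<in> bar_cycles G \<rho> n"
  show "z \<in> bar_boundaries G \<rho> n"
  proof (rule ccontr)
    assume "z \<notin> bar_boundaries G \<rho> n"
    then obtain \<phi> where \<phi>: "Vector_Spaces.linear fscale (*) \<phi>"
        "\<And>b. b \<in> bar_boundaries G \<rho> n \<Longrightarrow> \<phi> b = 0" "\<phi> z = 1"
      using fs.separating_functional[OF subspace_bar_boundaries] by blast
    interpret \<phi>: Vector_Spaces.linear fscale "(*)" \<phi> by (rule \<phi>(1))
    define f where "f v = \<phi> (bar_basis v)" for v
    have zW: "finite {w. z w \<noteq> 0}" "\<And>w. z w \<noteq> 0 \<Longrightarrow> length w = n \<and> set w \<subseteq> carrier G"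
      using z by (auto simp: bar_cycles_def bar_chains_def)
    have "z = (\<Sum>w | z w \<noteq> 0. fscale (z w) (bar_basis w))"
    proof
      fix v
      have "(\<Sum>w | z w \<noteq> 0. fscale (z w) (bar_basis w)) v = (\<Sum>w | z w \<noteq> 0. if v = w then z w else 0)"
        unfolding sum_fun_apply by (intro sum.cong) (auto simp: fscale_def bar_basis_def)
      then show "z v = (\<Sum>w | z w \<noteq> 0. fscale (z w) (bar_basis w)) v" using zW(1) by simp
    qed
    then have "\<phi> z = \<phi> (\<Sum>w | z w \<noteq> 0. fscale (z w) (bar_basis w))" by (rule arg_cong)
    then have \<phi>z: "\<phi> z = (\<Sum>w | z w \<noteq> 0. z w * f w)"
      by (simp add: \<phi>.sum \<phi>.scale f_def)
    have "bar_cobd G \<rho> f w = 0" if w: "length w = Suc n" "set w \<subseteq> carrier G" for w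
    proof -
      have "bar_cobd G \<rho> f w = \<phi> (bar_bd G \<rho> (Suc n) (bar_basis w))"
        by (simp add: bar_bd_basis[OF w(1)] bar_cobd_def f_def \<phi>.add \<phi>.sum \<phi>.scale)
      also have "\<dots> = 0"
        using bar_basis_chains[OF w] by (intro \<phi>(2)) (auto simp: bar_boundaries_def)
      finally show ?thesis .
    qed
    then have "homogeneous \<rho> n f \<in> coboundaries (carrier G) \<rho>"
      using homogeneous_cocycle[OF \<rho>] acyclic by (auto simp: acyclic_cochains_def)
    then obtain u where u: "u \<in> cochains (carrier G) \<rho>" "homogeneous \<rho> n f = cobd u"
      by (auto simp: coboundaries_def)
    have fw: "f w = cobd u (walk \<one> w)" if "z w \<noteq> 0" for w
      using homogeneous_walk[OF \<rho>, of w n f] zW(2)[OF that] u(2) by simp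
    have "(\<Sum>w | z w \<noteq> 0. z w * f w) = 0"
    proof (cases "n = 0")
      case True
      \<comment> \<open>In degree zero \<open>f w\<close> is \<open>cobd u [\<one>] = u []\<close>,
        which is zero for a cochain.\<close>
      then have "f w = 0" if "z w \<noteq> 0" for w
        using fw[OF that] zW(2)[OF that] u(1) by (simp add: cochains_def)
      then show ?thesis by simp
    next
      case False
      have "f w = bar_cobd G \<rho> (\<lambda>v. u (walk \<one> v)) w" if "z w \<noteq> 0" for w
        using fw[OF that] cobd_walk[OF \<rho> u(1), of w] zW(2)[OF that] False by auto
      then have "(\<Sum>w | z w \<noteq> 0. z w * f w)
          = (\<Sum>w | z w \<noteq> 0. z w * bar_cobd G \<rho> (\<lambda>v. u (walk \<one> v)) w)"
        by (intro sum.cong) auto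
      then show ?thesis using pairing_bar_cycle[OF z] False by simp
    qed
    then show False using \<phi>z \<phi>(3) by simp
  qed
qed

lemma char_variety_subset:
  "char_variety G i 1 \<subseteq> {\<rho> \<in> chars (carrier G). \<not> acyclic_cochains (carrier G) \<rho>}"
proof
  fix \<rho> assume "\<rho> \<in> char_variety G i 1"
  then have \<rho>: "\<rho> \<in> chars (carrier G)" "homology_dim_ge G \<rho> i 1"
    by (auto simp: char_variety_def)
  then obtain zs where zs: "length zs = 1" "set zs \<subseteq> bar_cycles G \<rho> i"
      "\<And>a. (\<lambda>v. \<Sum>k<1. a k * (zs ! k) v) \<in> bar_boundaries G \<rho> i \<Longrightarrow> \<forall>k<1. a k = 0"
    unfolding homology_dim_ge_def by blast
  have "zs ! 0 \<in> bar_cycles G \<rho> i" using zs(1,2) by (metis less_numeral_extra(1) nth_mem subsetD)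
  \<comment> \<open>The combination with coefficient one is \<open>zs ! 0\<close> itself.\<close>
  moreover have "zs ! 0 \<notin> bar_boundaries G \<rho> i" using zs(3)[of "\<lambda>_. 1"] by auto
  ultimately show "\<rho> \<in> {\<rho> \<in> chars (carrier G). \<not> acyclic_cochains (carrier G) \<rho>}"
    using \<rho>(1) acyclic_bar[OF \<rho>(1)] by blast
qed

end

theorem theorem3p5:
  fixes G :: "('a, 'b) monoid_scheme"
  assumes "group G"
    and "finitely_generated_group G"
    and "virtually_polycyclic G"
  shows "\<forall>i. finite (char_variety G i 1)"
proof
  fix i
  interpret group G by (rule assms(1))
  show "finite (char_variety G i 1)"
    using finite_cohomology_virtually_polycyclic[OF assms(2,3)] char_variety_subset[of i]
    unfolding finite_cohomology_def by (meson finite_subset)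
qed

end
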